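(* Let $\mathbf{Y}$ be a $d$-variate H\"usler--Reiss random vector with variogram matrix $\Gamma$. If $\Gamma$ satisfies the metric property, i.e. $$\Gamma_{ij}\le\Gamma_{ik}+\Gamma_{jk}\quad\text{for all } i,j,k\in\{1,\ldots,d\},$$ then $\mathbf{Y}$ is extremal associated.
   Context: Write $[d]=\{1,\ldots,d\}$ and $\mathbf{1}=(1,\ldots,1)^T\in\mathbb{R}^d$. Association: a function $f:\mathbb{R}^d\to\mathbb{R}$ is increasing if $x_i\le x_i'$ for all $i$ implies $f(\mathbf{x})\le f(\mathbf{x}')$. A random vector $\mathbf{X}$ is (positively) associated if $\operatorname{Cov}(f(\mathbf{X}),g(\mathbf{X}))\ge 0$ for all increasing $f,g$ for which the covariance exists. Multivariate Pareto vector: a random vector $\mathbf{Y}$ supported on $\mathcal{L}=\{\mathbf{x}\in\mathbb{R}^d:\|\mathbf{x}\|_\infty>0\}$ (where, for threshold exceedances, $\|\mathbf{x}\|_\infty>0$ means that at least one coordinate of $\mathbf{x}$ is positive) that arises as the limit $\mathbb{P}(\mathbf{Y}\le\mathbf{y})=\lim_{u\to\infty}\mathbb{P}(\mathbf{X}-u\mathbf{1}\le\mathbf{y}\mid\|\mathbf{X}\|_\infty>u)$ for a random vector $\mathbf{X}$ that is multivariate regularly varying and normalized to standard exponential margins. For $k\in[d]$ let $\mathbf{Y}^k$ denote a random vector with the conditional law of $\mathbf{Y}$ given $Y_k>0$. It is a known property that $\mathbf{Y}^k\stackrel{d}{=}E\mathbf{1}+\mathbf{W}^k$, where $E$ is standard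 exponential and independent of an $\mathbb{R}^d$-valued random vector $\mathbf{W}^k$ (the $k$th extremal function) with $W^k_k=0$ almost surely. H\"usler--Reiss distribution: let $\Gamma$ be a symmetric $d\times d$ matrix with zero diagonal that is strictly conditionally negative definite, i.e. $\mathbf{x}^T\Gamma\mathbf{x}<0$ for all $\mathbf{x}\neq\mathbf{0}$ with $\mathbf{x}^T\mathbf{1}=0$. The multivariate Pareto vector $\mathbf{Y}$ is H\"usler--Reiss with variogram matrix $\Gamma$ if for each $k\in[d]$ the subvector $\mathbf{W}^k_{\setminus k}=(W^k_i)_{i\neq k}$ of the $k$th extremal function is a $(d-1)$-variate Gaussian with covariance matrix $\Sigma^{(k)}$ given by $\Sigma^{(k)}_{ij}=(\Gamma_{ik}+\Gamma_{jk}-\Gamma_{ij})/2$, $i,j\neq k$, and mean vector $-\operatorname{diag}(\Sigma^{(k)})/2$. Extremal association: $\mathbf{Y}$ is called extremal associated if and only if $\mathbf{Y}^k$ is associated for each $k\in[d]$. *)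

theory Defs
  imports "HOL-Probability.Probability"
begin

definition covariance :: "'a measure \<Rightarrow> ('a \<Rightarrow> real) \<Rightarrow> ('a \<Rightarrow> real) \<Rightarrow> real" where
  "covariance M X Y =
     (\<integral>\<omega>. (X \<omega> - (\<integral>\<omega>'. X \<omega>' \<partial>M)) * (Y \<omega> - (\<integral>\<omega>'. Y \<omega>' \<partial>M)) \<partial>M)"

(* Vectors are ordered componentwise, so "mono f" says that f is increasing in the stated sense.
   The covariance exists when the means of f(X), g(X) and f(X) g(X) do. *)
definition associated :: "'a measure \<Rightarrow> ('a \<Rightarrow> real ^ 'd) \<Rightarrow> bool" where
  "associated M X \<longleftrightarrow>
     (\<forall>f g :: real ^ 'd \<Rightarrow> real. mono f \<longrightarrow> mono g \<longrightarrow>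
        integrable M (\<lambda>\<omega>. f (X \<omega>)) \<longrightarrow> integrable M (\<lambda>\<omega>. g (X \<omega>)) \<longrightarrow>
        integrable M (\<lambda>\<omega>. f (X \<omega>) * g (X \<omega>)) \<longrightarrow>
        0 \<le> covariance M (\<lambda>\<omega>. f (X \<omega>)) (\<lambda>\<omega>. g (X \<omega>)))"

(* Multivariate regular variation on the cone [0,infinity)^d without the origin: there are a
   normalisation b(t) tending to infinity and a nonzero limit measure Lambda, finite away from the
   origin, such that t P(Z / b(t) : A) tends to Lambda(A) for every Lambda-continuity set A bounded
   away from the origin. *)
definition regularly_varying :: "'a measure \<Rightarrow> ('a \<Rightarrow> real ^ 'd) \<Rightarrow> bool" where
  "regularly_varying M Z \<longleftrightarrow>
     (AE \<omega> in M. 0 \<le> Z \<omega>) \<and>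
     (\<exists>(b :: real \<Rightarrow> real) (\<Lambda> :: (real ^ 'd) measure).
        filterlim b at_top at_top \<and>
        sets \<Lambda> = sets borel \<and>
        emeasure \<Lambda> (- {z. 0 \<le> z \<and> z \<noteq> 0}) = 0 \<and>
        emeasure \<Lambda> UNIV \<noteq> 0 \<and>
        (\<forall>A \<in> sets borel. 0 \<notin> closure A \<longrightarrow>
           emeasure \<Lambda> A < \<infinity> \<and>
           (emeasure \<Lambda> (frontier A) = 0 \<longrightarrow>
              ((\<lambda>t. t * measure M {\<omega> \<in> space M. (1 / b t) *\<^sub>R Z \<omega> \<in> A})
                 \<longlongrightarrow> measure \<Lambda> A) at_top)))"

definition standard_exponential :: "real measure" where
  "standard_exponential = density lborel (exponential_density 1)"

definition standard_exponential_margins :: "'a measure \<Rightarrow> ('a \<Rightarrow> real ^ 'd) \<Rightarrow> bool" where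
  "standard_exponential_margins M X \<longleftrightarrow>
     (\<forall>i. distr M borel (\<lambda>\<omega>. X \<omega> $ i) = standard_exponential)"

(* The event that the sup norm of x exceeds u, in the sense used for threshold exceedances: some
   coordinate (without absolute value) is larger than u. *)
definition exceeds :: "real ^ 'd \<Rightarrow> real \<Rightarrow> bool" where
  "exceeds x u \<longleftrightarrow> (\<exists>i. x $ i > u)"

(* Y depends on X only through its distribution, so X is taken to be the identity on (R^d, N).
   Standard exponential margins put X on the logarithmic scale: the regularly varying vector is
   exp X, whose margins are standard Pareto. *)
definition multivariate_pareto :: "'a measure \<Rightarrow> ('a \<Rightarrow> real ^ 'd) \<Rightarrow> bool" where
  "multivariate_pareto M Y \<longleftrightarrow>
     (AE \<omega> in M. exceeds (Y \<omega>) 0) \<and>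
     (\<exists>N :: (real ^ 'd) measure.
        prob_space N \<and> sets N = sets borel \<and>
        standard_exponential_margins N (\<lambda>x. x) \<and>
        regularly_varying N (\<lambda>x. \<chi> i. exp (x $ i)) \<and>
        (\<forall>y. ((\<lambda>u. \<P>(x in N. x - u *\<^sub>R 1 \<le> y \<bar> exceeds x u))
               \<longlongrightarrow> \<P>(\<omega> in M. Y \<omega> \<le> y)) at_top))"

(* The law of Y^k, i.e. of Y conditioned on Y_k > 0. *)
definition exceedance_law ::
  "'a measure \<Rightarrow> ('a \<Rightarrow> real ^ 'd) \<Rightarrow> 'd \<Rightarrow> (real ^ 'd) measure" where
  "exceedance_law M Y k = uniform_measure (distr M borel Y) {y. y $ k > 0}"

(* L is the law of the kth extremal function W^k: Y^k has the law of E 1 + W^k under the product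
   of the standard exponential law and L. *)
definition extremal_function_law ::
  "'a measure \<Rightarrow> ('a \<Rightarrow> real ^ 'd) \<Rightarrow> 'd \<Rightarrow> (real ^ 'd) measure \<Rightarrow> bool" where
  "extremal_function_law M Y k L \<longleftrightarrow>
     prob_space L \<and> sets L = sets borel \<and>
     (AE w in L. w $ k = 0) \<and>
     exceedance_law M Y k =
       distr (standard_exponential \<Otimes>\<^sub>M L) borel (\<lambda>(e, w). e *\<^sub>R 1 + w)"

definition normal_law :: "real \<Rightarrow> real \<Rightarrow> real measure" where
  "normal_law m s = (if s = 0 then return borel m else density lborel (normal_density m s))"

(* The family (X_i), i in the finite set I, is jointly Gaussian (every linear combination is
   univariate normal, possibly degenerate) with mean vector mu and covariance matrix Sigma. *)
definition gaussian_vector ::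
  "'a measure \<Rightarrow> 'i set \<Rightarrow> ('i \<Rightarrow> 'a \<Rightarrow> real) \<Rightarrow> ('i \<Rightarrow> real) \<Rightarrow> ('i \<Rightarrow> 'i \<Rightarrow> real) \<Rightarrow> bool" where
  "gaussian_vector M I X \<mu> \<Sigma> \<longleftrightarrow>
     (\<forall>i\<in>I. X i \<in> borel_measurable M) \<and>
     (\<forall>a. \<exists>m s. s \<ge> 0 \<and> distr M borel (\<lambda>\<omega>. \<Sum>i\<in>I. a i * X i \<omega>) = normal_law m s) \<and>
     (\<forall>i\<in>I. (\<integral>\<omega>. X i \<omega> \<partial>M) = \<mu> i) \<and>
     (\<forall>i\<in>I. \<forall>j\<in>I. covariance M (X i) (X j) = \<Sigma> i j)"

definition variogram_matrix :: "real ^ 'd ^ 'd \<Rightarrow> bool" where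
  "variogram_matrix \<Gamma> \<longleftrightarrow>
     transpose \<Gamma> = \<Gamma> \<and> (\<forall>i. \<Gamma> $ i $ i = 0) \<and>
     (\<forall>x. x \<noteq> 0 \<longrightarrow> x \<bullet> 1 = 0 \<longrightarrow> x \<bullet> (\<Gamma> *v x) < 0)"

definition Sigma_k :: "real ^ 'd ^ 'd \<Rightarrow> 'd \<Rightarrow> 'd \<Rightarrow> 'd \<Rightarrow> real" where
  "Sigma_k \<Gamma> k i j = (\<Gamma> $ i $ k + \<Gamma> $ j $ k - \<Gamma> $ i $ j) / 2"

definition husler_reiss ::
  "'a measure \<Rightarrow> ('a \<Rightarrow> real ^ 'd) \<Rightarrow> real ^ 'd ^ 'd \<Rightarrow> bool" where
  "husler_reiss M Y \<Gamma> \<longleftrightarrow>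
     variogram_matrix \<Gamma> \<and> multivariate_pareto M Y \<and>
     (\<forall>k. \<exists>L. extremal_function_law M Y k L \<and>
        gaussian_vector L (- {k}) (\<lambda>i w. w $ i)
          (\<lambda>i. - Sigma_k \<Gamma> k i i / 2) (Sigma_k \<Gamma> k))"

definition extremal_associated :: "'a measure \<Rightarrow> ('a \<Rightarrow> real ^ 'd) \<Rightarrow> bool" where
  "extremal_associated M Y \<longleftrightarrow> (\<forall>k. associated (exceedance_law M Y k) (\<lambda>y. y))"

end

theory Submission
  imports Defs
begin

text \<open>
  The metric property says exactly that the covariances \<open>(\<Gamma>\<^sub>i\<^sub>k + \<Gamma>\<^sub>j\<^sub>k - \<Gamma>\<^sub>i\<^sub>j) / 2\<close> of the extremal function
  \<open>W\<^sup>k\<close> are nonnegative.  Pitt's theorem states that a Gaussian vector with nonnegative covariances is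
  associated; since \<open>Y\<^sup>k\<close> is \<open>E 1 + W\<^sup>k\<close> with \<open>E\<close> independent of \<open>W\<^sup>k\<close>, association of \<open>Y\<^sup>k\<close> follows by
  conditioning on \<open>E\<close> and applying Chebyshev's inequality for a single real variable
  (\<open>covariance_nonneg_smooth_mixture\<close>).

  Pitt's theorem is obtained here, for smooth increasing \<open>f\<close> and \<open>g\<close>, by a discrete form of his interpolation
  argument.  For a Gaussian vector \<open>X\<close> scaled by a small \<open>s\<close>, the covariance of \<open>f (a + s X)\<close> and
  \<open>g (b + s X)\<close> is \<open>s\<^sup>2\<close> times a nonnegative combination of the covariances of \<open>X\<close>, up to an error of order
  \<open>s\<^sup>3\<close> (\<open>small_scale_covariance\<close>).  The sum of two independent copies of \<open>s X\<close> has the law of \<open>sqrt 2 s X\<close>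
  (\<open>centred_gaussian_stable\<close>), and a lower bound \<open>- c\<close> for the covariance at scale \<open>s\<close>, uniform in \<open>a\<close> and
  \<open>b\<close>, gives the lower bound \<open>- 2 c\<close> at scale \<open>sqrt 2 s\<close> (\<open>covariance_doubling\<close>).  Reaching scale \<open>1\<close> from
  scale \<open>s\<close> multiplies the error by \<open>1 / s\<^sup>2\<close>, so an error of order \<open>s\<close> remains and vanishes in the limit.

  A general increasing function is first truncated and then smoothed by a compactly supported kernel.
  The smoothed functions at \<open>x\<close> lie between the values of \<open>f\<close> at \<open>x - \<delta> 1\<close> and \<open>x + \<delta> 1\<close>
  (\<open>smoothly_increasing_approximation\<close>), and \<open>f\<close> is increasing along every line in direction \<open>1\<close>, so they
  converge at almost every point of such a line.  As \<open>E\<close> has a density, they converge almost surely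
  under the law of \<open>E 1 + W\<^sup>k\<close>, although \<open>W\<^sup>k\<close> itself lives on a hyperplane.

  The convolution identity rests on the uniqueness theorem for characteristic functions of vectors
  (\<open>prob_measure_eqI_char_vec\<close>), which is derived from the one on the real line by induction on the
  number of coordinates.
\<close>

section \<open>Uniqueness of characteristic functions in several dimensions\<close>

text \<open>Reduces to the uniqueness theorem for probability measures by dividing by the total mass, which
  is the value of the characteristic function at \<open>0\<close>.\<close>

lemma finite_measure_eqI_char:
  fixes M N :: "real measure"
  assumes M: "finite_measure M" "sets M = sets borel"
    and N: "finite_measure N" "sets N = sets borel"
    and eq: "\<And>t. char M t = char N t"
  shows "M = N"
proof -
  interpret M: finite_measure M by fact
  interpret N: finite_measure N by fact
  have spM: "space M = UNIV" and spN: "space N = UNIV"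
    using sets_eq_imp_space_eq[OF M(2)] sets_eq_imp_space_eq[OF N(2)] by auto
  note [measurable_cong] = M(2) N(2)
  define c where "c = measure M UNIV"
  have "complex_of_real (measure M UNIV) = complex_of_real (measure N UNIV)"
    using eq[of 0] by (simp add: char_def spM spN scaleR_conv_of_real)
  then have cN: "measure N UNIV = c" by (simp add: c_def)
  show ?thesis
  proof (cases "c = 0")
    case True
    have "emeasure M A = 0" "emeasure N A = 0" for A
      using True cN M.emeasure_eq_measure[of UNIV] N.emeasure_eq_measure[of UNIV]
      by (metis c_def emeasure_space ennreal_0 le_zero_eq spM spN)+
    then show ?thesis
      using M N by (intro measure_eqI) auto
  next
    case False
    then have c: "c > 0" using c_def by (simp add: zero_less_measure_iff)
    define normalised where "normalised Q = density Q (\<lambda>_. ennreal (1 / c))" for Q :: "real measure"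
    have prob: "real_distribution (normalised Q)"
      if "finite_measure Q" "sets Q = sets borel" "measure Q UNIV = c" for Q
    proof -
      interpret Q: finite_measure Q by fact
      have sp: "space Q = UNIV" using sets_eq_imp_space_eq[OF that(2)] by auto
      have "emeasure (normalised Q) (space (normalised Q)) = ennreal (1/c) * ennreal c"
        using that by (simp add: normalised_def emeasure_density sp Q.emeasure_eq_measure
            nn_integral_cmult_indicator measurable_def)
      also have "\<dots> = 1" using c by (simp flip: ennreal_mult')
      finally show ?thesis
        using that by (intro real_distribution.intro prob_spaceI real_distribution_axioms.intro)
          (auto simp: normalised_def sp)
    qed
    have char_norm: "char (normalised Q) t = (1/c) *\<^sub>R char Q t"
      if [measurable_cong]: "sets Q = sets borel" for Q t
      unfolding char_def normalised_def using c by (subst integral_density) auto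
    have "normalised M = normalised N"
      using prob[OF M] prob[OF N cN] c_def char_norm M N eq
      by (intro Levy_uniqueness) (auto simp: fun_eq_iff)
    then have norm_eq: "emeasure (normalised M) A = emeasure (normalised N) A" for A by simp
    have unnormalise: "emeasure Q A = ennreal c * emeasure (normalised Q) A"
      if Q: "sets Q = sets borel" and A: "A \<in> sets borel" for Q A
    proof -
      have "ennreal c * emeasure (normalised Q) A = ennreal c * (ennreal (1/c) * emeasure Q A)"
        using A Q by (simp add: normalised_def emeasure_density nn_integral_cmult_indicator)
      also have "\<dots> = emeasure Q A" using c by (simp flip: ennreal_mult' mult.assoc)
      finally show ?thesis by simp
    qed
    show ?thesis
      using M N unnormalise norm_eq by (intro measure_eqI) auto
  qed
qed

text \<open>Indicators of coordinates can be inserted under the characteristic function one at a time.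
  In the inductive step, the one-dimensional uniqueness theorem applies to the image in the new
  coordinate of a weighted measure.  The weight \<open>iexp (t \<bullet> x)\<close> is complex, so it is replaced by the
  nonnegative weights \<open>1 + cos (t \<bullet> x)\<close> and \<open>1 + sin (t \<bullet> x)\<close>, whose characteristic functions are
  combinations of the ones at shifted frequencies, hence known by the induction hypothesis.\<close>

lemma char_determines_rectangle_integrals:
  fixes \<mu> \<nu> :: "(real ^ 'd) measure" and A :: "'d \<Rightarrow> real set"
  assumes \<mu>: "finite_measure \<mu>" "sets \<mu> = sets borel"
    and \<nu>: "finite_measure \<nu>" "sets \<nu> = sets borel"
    and eq: "\<And>t. (CLINT x|\<mu>. iexp (t \<bullet> x)) = (CLINT x|\<nu>. iexp (t \<bullet> x))"
    and A: "\<And>j. A j \<in> sets borel"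
  shows "(CLINT x|\<mu>. (\<Prod>j\<in>J. indicator (A j) (x $ j)) *\<^sub>R iexp (t \<bullet> x)) =
         (CLINT x|\<nu>. (\<Prod>j\<in>J. indicator (A j) (x $ j)) *\<^sub>R iexp (t \<bullet> x))"
proof -
  note [measurable] = A
  have "finite J" by simp
  then show ?thesis
  proof (induction J arbitrary: t rule: finite_induct)
    case empty
    then show ?case using eq by simp
  next
    case (insert j J)
    define P where "P x = (\<Prod>i\<in>J. indicator (A i) (x $ i) :: real)" for x :: "real ^ 'd"
    have P[measurable]: "P \<in> borel_measurable borel" unfolding P_def by measurable
    have P01: "0 \<le> P x" "P x \<le> 1" for x
      unfolding P_def by (auto intro!: prod_nonneg prod_le_1)
    have IH: "(CLINT x|\<mu>. P x *\<^sub>R iexp (t \<bullet> x)) = (CLINT x|\<nu>. P x *\<^sub>R iexp (t \<bullet> x))" for t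
      using insert.IH[of t] by (simp add: P_def)
    have intg: "integrable Q (\<lambda>x. (P x * h x) *\<^sub>R iexp (t \<bullet> x))"
      if Q: "finite_measure Q" "sets Q = sets borel" and [measurable]: "h \<in> borel_measurable borel"
        and h: "\<And>x. \<bar>h x\<bar> \<le> 1" for Q :: "(real ^ 'd) measure" and h t
    proof -
      interpret finite_measure Q by fact
      note [measurable_cong] = Q(2)
      have "\<bar>P x * h x\<bar> \<le> 1" for x
        using mult_mono[of "\<bar>P x\<bar>" 1 "\<bar>h x\<bar>" 1] P01[of x] h[of x] by (simp add: abs_mult)
      then show ?thesis
        by (intro integrable_const_bound[where B=1]) (auto simp: norm_mult)
    qed
    have intg1: "integrable Q (\<lambda>x. P x *\<^sub>R iexp (t \<bullet> x))"
      if Q: "finite_measure Q" "sets Q = sets borel" for Q :: "(real ^ 'd) measure" and t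
      using intg[OF Q, of "\<lambda>_. 1" t] by simp
    \<comment> \<open>For a trigonometric weight \<open>1 + h\<close> the image of \<open>P (1 + h) \<mu>\<close> in the coordinate \<open>j\<close> is a
        positive measure on the line, so it is determined by its characteristic function.\<close>
    have weighted: "(LINT x|\<mu>. (P x * (1 + h x)) * indicator (A j) (x $ j)) =
        (LINT x|\<nu>. (P x * (1 + h x)) * indicator (A j) (x $ j))"
      if h[measurable]: "h \<in> borel_measurable borel" and h1: "\<And>x. \<bar>h x\<bar> \<le> 1"
        and heq: "\<And>s. (CLINT x|\<mu>. (P x * h x) *\<^sub>R iexp (axis j s \<bullet> x)) =
                       (CLINT x|\<nu>. (P x * h x) *\<^sub>R iexp (axis j s \<bullet> x))" for h
    proof -
      define w where "w x = P x * (1 + h x)" for x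
      have [measurable]: "w \<in> borel_measurable borel" unfolding w_def by measurable
      have w: "0 \<le> w x" "w x \<le> 2" for x
        using P01[of x] h1[of x] mult_mono[of "P x" 1 "1 + h x" 2]
        by (auto simp: w_def abs_le_iff intro!: mult_nonneg_nonneg)
      define D where "D Q = distr (density Q (\<lambda>x. ennreal (w x))) borel (\<lambda>x. x $ j)" for Q
      have D: "finite_measure (D Q)" "sets (D Q) = sets borel"
        "char (D Q) s = (CLINT x|Q. P x *\<^sub>R iexp (axis j s \<bullet> x)) + (CLINT x|Q. (P x * h x) *\<^sub>R iexp (axis j s \<bullet> x))"
        "measure (D Q) (A j) = (LINT x|Q. w x * indicator (A j) (x $ j))"
        if Q: "finite_measure Q" "sets Q = sets borel" for Q s
      proof -
        interpret finite_measure Q by fact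
        note [measurable_cong] = Q(2)
        have wi: "integrable Q w"
          using w by (intro integrable_const_bound[where B=2]) auto
        have "emeasure (density Q (\<lambda>x. ennreal (w x))) (space Q) = (\<integral>\<^sup>+x. ennreal (w x) \<partial>Q)"
          by (simp add: emeasure_density cong: nn_integral_cong)
        also have "\<dots> < \<infinity>" using wi w(1) by (simp add: nn_integral_eq_integral)
        finally have fd: "finite_measure (density Q (\<lambda>x. ennreal (w x)))"
          by (intro finite_measureI) auto
        show "finite_measure (D Q)" unfolding D_def
          by (intro finite_measure.finite_measure_distr fd) measurable
        show "sets (D Q) = sets borel" by (simp add: D_def)
        have "char (D Q) s = (CLINT x|density Q (\<lambda>x. ennreal (w x)). iexp (s * x $ j))"
          unfolding char_def D_def by (subst integral_distr) auto
        also have "\<dots> = (CLINT x|Q. w x *\<^sub>R iexp (s * x $ j))"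
          using w by (subst integral_density) auto
        also have "\<dots> = (CLINT x|Q. P x *\<^sub>R iexp (axis j s \<bullet> x) + (P x * h x) *\<^sub>R iexp (axis j s \<bullet> x))"
          by (intro Bochner_Integration.integral_cong refl)
            (auto simp: w_def inner_axis' scaleR_conv_of_real algebra_simps)
        also have "\<dots> = (CLINT x|Q. P x *\<^sub>R iexp (axis j s \<bullet> x)) + (CLINT x|Q. (P x * h x) *\<^sub>R iexp (axis j s \<bullet> x))"
          by (intro Bochner_Integration.integral_add intg1[OF Q] intg[OF Q] h h1)
        finally show "char (D Q) s = \<dots>" .
        have "measure (D Q) (A j) = (LINT y|D Q. indicator (A j) y)"
          by (simp add: D_def space_density)
        also have "\<dots> = (LINT x|density Q (\<lambda>x. ennreal (w x)). indicator (A j) (x $ j))"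
          unfolding D_def by (subst integral_distr) auto
        also have "\<dots> = (LINT x|Q. w x * indicator (A j) (x $ j))"
          using w by (subst integral_density) auto
        finally show "measure (D Q) (A j) = \<dots>" .
      qed
      have "D \<mu> = D \<nu>"
        using D[OF \<mu>] D[OF \<nu>] IH heq by (intro finite_measure_eqI_char) auto
      then show ?thesis
        using D(4)[OF \<mu>] D(4)[OF \<nu>] by (simp add: w_def)
    qed
    define PA where "PA x = P x * indicator (A j) (x $ j)" for x
    have [measurable]: "PA \<in> borel_measurable borel" unfolding PA_def by measurable
    have PA: "0 \<le> PA x" "PA x \<le> 1" for x
      using P01[of x] by (auto simp: PA_def indicator_def)
    have intPA: "integrable Q (\<lambda>x. PA x * h x)"
      if Q: "finite_measure Q" "sets Q = sets borel" and [measurable]: "h \<in> borel_measurable borel"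
        and h: "\<And>x. \<bar>h x\<bar> \<le> 1" for Q :: "(real ^ 'd) measure" and h
    proof -
      interpret finite_measure Q by fact
      note [measurable_cong] = Q(2)
      have "\<bar>PA x * h x\<bar> \<le> 1" for x
        using mult_mono[of "\<bar>PA x\<bar>" 1 "\<bar>h x\<bar>" 1] PA[of x] h[of x] by (simp add: abs_mult)
      then show ?thesis
        by (intro integrable_const_bound[where B=1]) auto
    qed
    have trig: "(LINT x|\<mu>. PA x * h x) = (LINT x|\<nu>. PA x * h x)"
      if h[measurable]: "h \<in> borel_measurable borel" and h1: "\<And>x. \<bar>h x\<bar> \<le> 1"
        and heq: "\<And>s. (CLINT x|\<mu>. (P x * h x) *\<^sub>R iexp (axis j s \<bullet> x)) =
                       (CLINT x|\<nu>. (P x * h x) *\<^sub>R iexp (axis j s \<bullet> x))" for h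
    proof -
      have split: "(LINT x|Q. (P x * (1 + h x)) * indicator (A j) (x $ j)) =
          (LINT x|Q. PA x * 1) + (LINT x|Q. PA x * h x)"
        if Q: "finite_measure Q" "sets Q = sets borel" for Q
      proof -
        have "(LINT x|Q. (P x * (1 + h x)) * indicator (A j) (x $ j)) = (LINT x|Q. PA x * 1 + PA x * h x)"
          by (simp add: PA_def algebra_simps)
        also have "\<dots> = (LINT x|Q. PA x * 1) + (LINT x|Q. PA x * h x)"
          by (intro Bochner_Integration.integral_add intPA[OF Q] h h1) auto
        finally show ?thesis .
      qed
      have "(LINT x|\<mu>. PA x * 1) = (LINT x|\<nu>. PA x * 1)"
        using weighted[of "\<lambda>_. 0"] by (simp add: PA_def)
      then show ?thesis
        using weighted[OF h h1 heq] split[OF \<mu>] split[OF \<nu>] by simp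
    qed
    have cos_sin: "(CLINT x|Q. (P x * cos (t \<bullet> x)) *\<^sub>R iexp (u \<bullet> x)) =
        ((CLINT x|Q. P x *\<^sub>R iexp ((u + t) \<bullet> x)) + (CLINT x|Q. P x *\<^sub>R iexp ((u - t) \<bullet> x))) / 2"
      "(CLINT x|Q. (P x * sin (t \<bullet> x)) *\<^sub>R iexp (u \<bullet> x)) =
        ((CLINT x|Q. P x *\<^sub>R iexp ((u + t) \<bullet> x)) - (CLINT x|Q. P x *\<^sub>R iexp ((u - t) \<bullet> x))) / (2 * \<i>)"
      if Q: "finite_measure Q" "sets Q = sets borel" for Q u
    proof -
      have *: "iexp ((u + t) \<bullet> x) = cis (t \<bullet> x) * iexp (u \<bullet> x)"
        "iexp ((u - t) \<bullet> x) = cis (- (t \<bullet> x)) * iexp (u \<bullet> x)" for x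
        by (auto simp: cis_conv_exp inner_add_left inner_diff_left algebra_simps simp flip: exp_add)
      show "(CLINT x|Q. (P x * cos (t \<bullet> x)) *\<^sub>R iexp (u \<bullet> x)) =
        ((CLINT x|Q. P x *\<^sub>R iexp ((u + t) \<bullet> x)) + (CLINT x|Q. P x *\<^sub>R iexp ((u - t) \<bullet> x))) / 2"
        unfolding Bochner_Integration.integral_add[OF intg1[OF Q] intg1[OF Q], symmetric]
          integral_divide_zero[symmetric]
        unfolding *
        by (intro Bochner_Integration.integral_cong refl)
          (auto simp: scaleR_conv_of_real complex_eq_iff cis.sel algebra_simps)
      show "(CLINT x|Q. (P x * sin (t \<bullet> x)) *\<^sub>R iexp (u \<bullet> x)) =
        ((CLINT x|Q. P x *\<^sub>R iexp ((u + t) \<bullet> x)) - (CLINT x|Q. P x *\<^sub>R iexp ((u - t) \<bullet> x))) / (2 * \<i>)"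
        unfolding Bochner_Integration.integral_diff[OF intg1[OF Q] intg1[OF Q], symmetric]
          integral_divide_zero[symmetric]
        unfolding *
        by (intro Bochner_Integration.integral_cong refl)
          (auto simp: scaleR_conv_of_real complex_eq_iff cis.sel Re_divide Im_divide power2_eq_square algebra_simps)
    qed
    have c: "(LINT x|\<mu>. PA x * cos (t \<bullet> x)) = (LINT x|\<nu>. PA x * cos (t \<bullet> x))"
      and s: "(LINT x|\<mu>. PA x * sin (t \<bullet> x)) = (LINT x|\<nu>. PA x * sin (t \<bullet> x))"
      by (rule trig; simp add: cos_sin[OF \<mu>] cos_sin[OF \<nu>] IH)+
    have PA_eq: "(\<Prod>i\<in>insert j J. indicator (A i) (x $ i)) = PA x" for x
      using insert.hyps by (simp add: PA_def P_def)
    have expand: "(CLINT x|Q. (\<Prod>i\<in>insert j J. indicator (A i) (x $ i)) *\<^sub>R iexp (t \<bullet> x)) =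
        complex_of_real (LINT x|Q. PA x * cos (t \<bullet> x)) + \<i> * complex_of_real (LINT x|Q. PA x * sin (t \<bullet> x))"
      if Q: "finite_measure Q" "sets Q = sets borel" for Q
    proof -
      have "(CLINT x|Q. (\<Prod>i\<in>insert j J. indicator (A i) (x $ i)) *\<^sub>R iexp (t \<bullet> x)) =
        (CLINT x|Q. complex_of_real (PA x * cos (t \<bullet> x)) + \<i> * complex_of_real (PA x * sin (t \<bullet> x)))"
        unfolding PA_eq by (intro Bochner_Integration.integral_cong refl)
          (auto simp: cis_conv_exp[symmetric] complex_eq_iff)
      also have "\<dots> = (CLINT x|Q. complex_of_real (PA x * cos (t \<bullet> x))) +
          (CLINT x|Q. \<i> * complex_of_real (PA x * sin (t \<bullet> x)))"
        by (intro Bochner_Integration.integral_add integrable_mult_right integrable_of_real intPA[OF Q]) auto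
      finally show ?thesis by (simp only: integral_complex_of_real integral_mult_right_zero)
    qed
    show ?case unfolding expand[OF \<mu>] expand[OF \<nu>] c s ..
  qed
qed

text \<open>At frequency \<open>0\<close>, the rectangle integrals are the values on orthants, and these generate the
  Borel sets.\<close>

lemma prob_measure_eqI_char_vec:
  fixes \<mu> \<nu> :: "(real ^ 'd) measure"
  assumes \<mu>: "prob_space \<mu>" "sets \<mu> = sets borel"
    and \<nu>: "prob_space \<nu>" "sets \<nu> = sets borel"
    and eq: "\<And>t. (CLINT x|\<mu>. iexp (t \<bullet> x)) = (CLINT x|\<nu>. iexp (t \<bullet> x))"
  shows "\<mu> = \<nu>"
proof -
  interpret \<mu>: prob_space \<mu> by fact
  interpret \<nu>: prob_space \<nu> by fact
  have orthant: "measure Q {..a} = Re (CLINT x|Q. (\<Prod>j\<in>UNIV. indicator {..a $ j} (x $ j)) *\<^sub>R iexp (0 \<bullet> x))"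
    if "prob_space Q" "sets Q = sets borel" for Q and a :: "real ^ 'd"
  proof -
    interpret prob_space Q by fact
    have sp: "space Q = UNIV" using sets_eq_imp_space_eq[OF that(2)] by simp
    have "(\<Prod>j\<in>UNIV. indicator {..a $ j} (x $ j)) = (indicator {..a} x :: real)" for x :: "real ^ 'd"
      by (auto simp: indicator_def less_eq_vec_def)
    then have "(CLINT x|Q. (\<Prod>j\<in>UNIV. indicator {..a $ j} (x $ j)) *\<^sub>R iexp (0 \<bullet> x)) =
        (CLINT x|Q. complex_of_real (indicator {..a} x))"
      by (simp add: scaleR_conv_of_real)
    also have "\<dots> = complex_of_real (measure Q {..a})"
      by (subst integral_of_real) (auto simp: sp that(2) integrable_indicator_iff less_top[symmetric])
    finally show ?thesis by simp
  qed
  have m: "emeasure \<mu> {..a} = emeasure \<nu> {..a}" for a :: "real ^ 'd"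
    unfolding \<mu>.emeasure_eq_measure \<nu>.emeasure_eq_measure orthant[OF \<mu>] orthant[OF \<nu>]
    by (subst char_determines_rectangle_integrals[OF _ \<mu>(2) _ \<nu>(2) eq])
      (auto simp: \<mu>.finite_measure_axioms \<nu>.finite_measure_axioms)
  show ?thesis
  proof (rule measure_eqI_generator_eq[where \<Omega>=UNIV and E="range atMost" and A="\<lambda>n::nat. {..real n *\<^sub>R 1}"])
    show "Int_stable (range (atMost :: real ^ 'd \<Rightarrow> _))"
    proof (clarsimp simp: Int_stable_def)
      fix a b :: "real ^ 'd"
      have "{..a} \<inter> {..b} = {..inf a b}" by auto
      then show "{..a} \<inter> {..b} \<in> range atMost" by simp
    qed
    show "sets \<mu> = sigma_sets UNIV (range atMost)" "sets \<nu> = sigma_sets UNIV (range atMost)"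
      using \<mu> \<nu> by (simp_all add: borel_eq_atMost)
    show "(\<Union>n. {..real n *\<^sub>R 1}) = (UNIV :: (real ^ 'd) set)"
    proof safe
      fix x :: "real ^ 'd"
      obtain n where "norm x \<le> real n" using real_arch_simple by blast
      then have "x $ i \<le> real n" for i using component_le_norm_cart[of x i] by (simp add: abs_le_iff)
      then show "x \<in> (\<Union>n. {..real n *\<^sub>R 1})" by (auto simp: less_eq_vec_def)
    qed auto
  qed (auto simp: m)
qed

section \<open>Centred Gaussian laws\<close>

lemma normal_law_eq_distr_std_normal:
  assumes "s \<ge> 0"
  shows "normal_law m s = distr std_normal_distribution borel (\<lambda>x. m + s * x)"
proof (cases "s = 0")
  case True
  interpret real_distribution std_normal_distribution by (rule real_dist_normal_dist)
  show ?thesis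
    using True by (simp add: normal_law_def distr_const)
next
  case False
  then have s: "s > 0" using assms by simp
  interpret real_distribution std_normal_distribution by (rule real_dist_normal_dist)
  have "distributed std_normal_distribution lborel (\<lambda>x. x) std_normal_density"
    by (auto simp: distributed_def distr_id2)
  from normal_density_affine[OF this, of s m] s
  have "distr std_normal_distribution lborel (\<lambda>x. m + s * x) = density lborel (normal_density m s)"
    by (auto simp: distributed_def)
  then show ?thesis
    using s by (simp add: normal_law_def cong: distr_cong)
qed

lemma
  assumes "s \<ge> 0"
  shows char_normal_law: "char (normal_law m s) t = iexp (t * m) * exp (- ((s * t)\<^sup>2) / 2)"
    and integrable_normal_law: "integrable (normal_law m s) (\<lambda>x. x)"
    and integral_normal_law: "(LINT x|normal_law m s. x) = m"
    and integrable_normal_law_power4: "integrable (normal_law 0 s) (\<lambda>x. x ^ 4)"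
    and distr_normal_law_centre: "distr (normal_law m s) borel (\<lambda>x. x - m) = normal_law 0 s"
proof -
  interpret real_distribution std_normal_distribution by (rule real_dist_normal_dist)
  note eq = normal_law_eq_distr_std_normal[OF assms]
  have "char (normal_law m s) t = (CLINT x|std_normal_distribution. iexp (t * m) * iexp ((s * t) * x))"
    unfolding char_def eq by (subst integral_distr) (auto simp: algebra_simps exp_add)
  also have "\<dots> = iexp (t * m) * char std_normal_distribution (s * t)"
    unfolding char_def by simp
  finally show "char (normal_law m s) t = iexp (t * m) * exp (- ((s * t)\<^sup>2) / 2)"
    by (simp add: char_std_normal_distribution exp_of_real)
  define S where "S = std_normal_distribution"
  interpret S: real_distribution S unfolding S_def by (rule real_dist_normal_dist)
  have moments: "integrable S (\<lambda>x. x)" "(LINT x|S. x) = 0" "integrable S (\<lambda>x. x ^ 4)"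
    using integrable_std_normal_distribution_moment[of 1] integrable_std_normal_distribution_moment[of 4]
      integral_std_normal_distribution_moment_odd[of 1] by (simp_all add: S_def)
  have eq: "normal_law m s = distr S borel (\<lambda>x. m + s * x)" for m
    using normal_law_eq_distr_std_normal[OF assms] by (simp add: S_def)
  have "integrable S (\<lambda>x. m + s * x)"
    using moments by (intro Bochner_Integration.integrable_add integrable_mult_right) auto
  then show "integrable (normal_law m s) (\<lambda>x. x)"
    unfolding eq by (subst integrable_distr_eq) auto
  have "(LINT x|S. m + s * x) = m"
    using moments S.prob_space by simp
  then show "(LINT x|normal_law m s. x) = m"
    unfolding eq by (subst integral_distr) auto
  have "integrable S (\<lambda>x. s ^ 4 * x ^ 4)"
    using moments by (intro integrable_mult_right) auto
  then show "integrable (normal_law 0 s) (\<lambda>x. x ^ 4)"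
    unfolding eq by (subst integrable_distr_eq) (auto simp: power_mult_distrib)
  show "distr (normal_law m s) borel (\<lambda>x. x - m) = normal_law 0 s"
    unfolding eq by (subst distr_distr) (auto simp: comp_def)
qed

text \<open>Characterising the law by its one-dimensional projections covers degenerate laws as well, such as
  that of a vector with a constant coordinate.\<close>

definition centred_gaussian :: "(real ^ 'd) measure \<Rightarrow> bool" where
  "centred_gaussian \<mu> \<longleftrightarrow> prob_space \<mu> \<and> sets \<mu> = sets borel \<and>
     (\<forall>t. \<exists>s \<ge> 0. distr \<mu> borel (\<lambda>x. t \<bullet> x) = normal_law 0 s)"

text \<open>For each single direction \<open>t\<close> this is the identity
  \<open>exp (- (sqrt 2 s)\<^sup>2 / 2) = (exp (- s\<^sup>2 / 2))\<^sup>2\<close>.\<close>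

lemma centred_gaussian_char_sqrt2:
  fixes \<mu> :: "(real ^ 'd) measure"
  assumes "centred_gaussian \<mu>"
  shows "(CLINT x|\<mu>. iexp (t \<bullet> (sqrt 2 *\<^sub>R x))) = (CLINT x|\<mu>. iexp (t \<bullet> x)) * (CLINT x|\<mu>. iexp (t \<bullet> x))"
proof -
  interpret prob_space \<mu> using assms by (simp add: centred_gaussian_def)
  have [measurable_cong]: "sets \<mu> = sets borel" using assms by (simp add: centred_gaussian_def)
  obtain s where s: "s \<ge> 0" "distr \<mu> borel (\<lambda>x. t \<bullet> x) = normal_law 0 s"
    using assms by (auto simp: centred_gaussian_def)
  have "(CLINT x|\<mu>. iexp (t \<bullet> (c *\<^sub>R x))) = char (distr \<mu> borel (\<lambda>x. t \<bullet> x)) c" for c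
    unfolding char_def by (subst integral_distr) auto
  then have *: "(CLINT x|\<mu>. iexp (t \<bullet> (c *\<^sub>R x))) = complex_of_real (exp (- ((s * c)\<^sup>2) / 2))" for c
    using s by (simp add: char_normal_law)
  have "exp (- ((s * sqrt 2)\<^sup>2) / 2) = exp (- ((s * 1)\<^sup>2) / 2) * exp (- ((s * 1)\<^sup>2) / 2)"
    by (simp add: power_mult_distrib flip: exp_add)
  then show ?thesis
    unfolding *[of "sqrt 2"] *[of 1, unfolded scaleR_one] by (simp only: of_real_mult)
qed

text \<open>By uniqueness of characteristic functions it suffices to compare one direction \<open>t\<close> at a time.  The
  identity carries a covariance inequality from scale \<open>s\<close> to scale \<open>sqrt 2 s\<close>.\<close>

lemma centred_gaussian_stable:
  fixes \<mu> :: "(real ^ 'd) measure"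
  assumes "centred_gaussian \<mu>"
  shows "distr (\<mu> \<Otimes>\<^sub>M \<mu>) borel (\<lambda>(x, y). x + y) = distr \<mu> borel (\<lambda>x. sqrt 2 *\<^sub>R x)"
proof -
  interpret prob_space \<mu> using assms by (simp add: centred_gaussian_def)
  interpret P: pair_prob_space \<mu> \<mu> ..
  have [measurable_cong]: "sets \<mu> = sets borel" using assms by (simp add: centred_gaussian_def)
  show ?thesis
  proof (rule prob_measure_eqI_char_vec)
    fix t :: "real ^ 'd"
    have int: "integrable (\<mu> \<Otimes>\<^sub>M \<mu>) (\<lambda>(x, y). iexp (t \<bullet> (x + y)))"
      by (intro P.integrable_const_bound[where B=1]) auto
    have "(CLINT x|distr (\<mu> \<Otimes>\<^sub>M \<mu>) borel (\<lambda>(x, y). x + y). iexp (t \<bullet> x)) =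
        (CLINT z|\<mu> \<Otimes>\<^sub>M \<mu>. (case z of (x, y) \<Rightarrow> iexp (t \<bullet> (x + y))))"
      by (subst integral_distr) (auto intro!: Bochner_Integration.integral_cong)
    also have "\<dots> = (CLINT x|\<mu>. CLINT y|\<mu>. iexp (t \<bullet> (x + y)))"
      using int by (subst P.integral_fst[symmetric]) auto
    also have "\<dots> = (CLINT x|\<mu>. CLINT y|\<mu>. iexp (t \<bullet> x) * iexp (t \<bullet> y))"
      by (simp add: inner_add_right exp_add algebra_simps)
    also have "\<dots> = (CLINT x|\<mu>. iexp (t \<bullet> x)) * (CLINT x|\<mu>. iexp (t \<bullet> x))"
      by simp
    also have "\<dots> = (CLINT x|\<mu>. iexp (t \<bullet> (sqrt 2 *\<^sub>R x)))"
      using centred_gaussian_char_sqrt2[OF assms] by simp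
    also have "\<dots> = (CLINT x|distr \<mu> borel (\<lambda>x. sqrt 2 *\<^sub>R x). iexp (t \<bullet> x))"
      by (subst integral_distr) auto
    finally show "(CLINT x|distr (\<mu> \<Otimes>\<^sub>M \<mu>) borel (\<lambda>(x, y). x + y). iexp (t \<bullet> x)) =
        (CLINT x|distr \<mu> borel (\<lambda>x. sqrt 2 *\<^sub>R x). iexp (t \<bullet> x))" .
  next
    show "prob_space (distr (\<mu> \<Otimes>\<^sub>M \<mu>) borel (\<lambda>(x, y). x + y))"
      by (rule P.prob_space_distr) measurable
    show "prob_space (distr \<mu> borel (\<lambda>x. sqrt 2 *\<^sub>R x))"
      by (rule prob_space_distr) measurable
  qed simp_all
qed

lemma centred_gaussian_coordinate:
  fixes \<mu> :: "(real ^ 'd) measure"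
  assumes "centred_gaussian \<mu>"
  shows "(LINT x|\<mu>. x $ i) = 0" and "integrable \<mu> (\<lambda>x. (x $ i) ^ 4)"
proof -
  have [measurable_cong]: "sets \<mu> = sets borel" using assms by (simp add: centred_gaussian_def)
  obtain s where s: "s \<ge> 0" "distr \<mu> borel (\<lambda>x. axis i 1 \<bullet> x) = normal_law 0 s"
    using assms by (auto simp: centred_gaussian_def)
  have d: "distr \<mu> borel (\<lambda>x. x $ i) = normal_law 0 s"
    using s(2) by (simp add: inner_axis')
  have "(LINT x|\<mu>. x $ i) = (LINT y|distr \<mu> borel (\<lambda>x. x $ i). y)"
    by (subst integral_distr) auto
  then show "(LINT x|\<mu>. x $ i) = 0"
    using integral_normal_law[OF s(1)] d by simp
  have "integrable (distr \<mu> borel (\<lambda>x. x $ i)) (\<lambda>y. y ^ 4)"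
    using integrable_normal_law_power4[OF s(1)] d by simp
  then show "integrable \<mu> (\<lambda>x. (x $ i) ^ 4)"
    by (subst (asm) integrable_distr_eq) auto
qed

lemma centred_gaussian_norm_power4:
  fixes \<mu> :: "(real ^ 'd) measure"
  assumes "centred_gaussian \<mu>"
  shows "integrable \<mu> (\<lambda>x. norm x ^ 4)"
proof -
  have [measurable_cong]: "sets \<mu> = sets borel" using assms by (simp add: centred_gaussian_def)
  show ?thesis
  proof (rule Bochner_Integration.integrable_bound)
    show "integrable \<mu> (\<lambda>x. real CARD('d) * (\<Sum>i\<in>UNIV. (x $ i) ^ 4))"
      by (intro integrable_mult_right Bochner_Integration.integrable_sum centred_gaussian_coordinate assms)
    show "AE x in \<mu>. norm (norm x ^ 4) \<le> norm (real CARD('d) * (\<Sum>i\<in>UNIV. (x $ i) ^ 4))"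
    proof (rule AE_I2)
      fix x :: "real ^ 'd"
      have "norm x ^ 4 = (\<Sum>i\<in>UNIV. (x $ i)\<^sup>2)\<^sup>2"
      proof -
        have "(norm x)\<^sup>2 = (\<Sum>i\<in>UNIV. (x $ i)\<^sup>2)"
          unfolding power2_norm_eq_inner by (simp add: inner_vec_def power2_eq_square)
        then show ?thesis using power_mult[of "norm x" 2 2] by simp
      qed
      also have "\<dots> \<le> (\<Sum>i\<in>(UNIV :: 'd set). (1::real)\<^sup>2) * (\<Sum>i\<in>UNIV. ((x $ i)\<^sup>2)\<^sup>2)"
        using Cauchy_Schwarz_ineq_sum[of "\<lambda>_. 1" "\<lambda>i. (x $ i)\<^sup>2" "UNIV :: 'd set"] by simp
      also have "\<dots> = real CARD('d) * (\<Sum>i\<in>UNIV. (x $ i) ^ 4)"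
        by (simp flip: power_mult)
      finally show "norm (norm x ^ 4) \<le> norm (real CARD('d) * (\<Sum>i\<in>UNIV. (x $ i) ^ 4))" by simp
    qed
  qed measurable
qed

text \<open>The coordinate \<open>k\<close> vanishes almost surely, so a linear form on the whole space agrees with one in
  the remaining coordinates; integrating it shows that its normal law is centred at the value
  of the form at the mean vector.  Products with the coordinate \<open>k\<close> integrate to \<open>0\<close>.\<close>

lemma gaussian_vector_centre:
  fixes L :: "(real ^ 'd) measure" and k :: 'd
  assumes L: "prob_space L" "sets L = sets borel" "AE w in L. w $ k = 0"
    and G: "gaussian_vector L (- {k}) (\<lambda>i w. w $ i) \<mu> \<Sigma>"
    and \<Sigma>: "\<And>i j. \<Sigma> i j \<ge> 0"
  defines "m \<equiv> \<chi> i. if i = k then 0 else \<mu> i"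
  defines "C \<equiv> distr L borel (\<lambda>w. w - m)"
  shows "centred_gaussian C" "\<And>i j. (LINT x|C. x $ i * x $ j) \<ge> 0"
proof -
  interpret prob_space L by fact
  note [measurable_cong] = L(2)
  have coord: "integrable L (\<lambda>w. w $ i)" if "i \<noteq> k" for i
  proof -
    obtain m' s where s: "s \<ge> 0" "distr L borel (\<lambda>w. \<Sum>j\<in>-{k}. (if j = i then 1 else 0) * w $ j) = normal_law m' s"
      using G unfolding gaussian_vector_def by meson
    have *: "(\<Sum>j\<in>-{k}. (if j = i then 1 else 0) * w $ j) = w $ i" for w :: "real ^ 'd"
      using that by (simp add: if_distrib[where f="\<lambda>a. a * _"] cong: if_cong)
    show ?thesis
      using integrable_normal_law[OF s(1), of m'] unfolding s(2)[unfolded *, symmetric]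
      by (subst (asm) integrable_distr_eq) auto
  qed
  have mean: "(LINT w|L. w $ i) = \<mu> i" if "i \<noteq> k" for i
    using G that by (auto simp: gaussian_vector_def)
  show "centred_gaussian C"
    unfolding centred_gaussian_def
  proof (intro conjI allI)
    show "prob_space C" unfolding C_def by (intro prob_space_distr) measurable
    show "sets C = sets borel" by (simp add: C_def)
    fix t :: "real ^ 'd"
    define S where "S w = (\<Sum>j\<in>-{k}. t $ j * w $ j)" for w :: "real ^ 'd"
    have [measurable]: "S \<in> borel_measurable borel" unfolding S_def by measurable
    obtain m' s where s: "s \<ge> 0" "distr L borel S = normal_law m' s"
      using G unfolding gaussian_vector_def S_def by meson
    have "m' = (LINT w|L. S w)"
      using integral_normal_law[OF s(1), of m'] unfolding s(2)[symmetric]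
      by (subst (asm) integral_distr) auto
    also have "\<dots> = (\<Sum>j\<in>-{k}. t $ j * \<mu> j)"
      unfolding S_def using coord mean by (subst Bochner_Integration.integral_sum) auto
    finally have m': "m' = (\<Sum>j\<in>-{k}. t $ j * \<mu> j)" .
    have inner: "t \<bullet> (w - m) = S w - m'" if "w $ k = 0" for w
    proof -
      have "t \<bullet> (w - m) = (\<Sum>j\<in>UNIV. t $ j * (w $ j - m $ j))"
        by (simp add: inner_vec_def)
      also have "\<dots> = (\<Sum>j\<in>-{k}. t $ j * (w $ j - m $ j))"
        using that by (intro sum.mono_neutral_right) (auto simp: m_def)
      also have "\<dots> = S w - m'"
        unfolding S_def m' sum_subtractf[symmetric]
        by (intro sum.cong) (auto simp: m_def algebra_simps)
      finally show ?thesis .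
    qed
    have "distr C borel (\<lambda>x. t \<bullet> x) = distr L borel (\<lambda>w. t \<bullet> (w - m))"
      unfolding C_def by (subst distr_distr) (auto simp: comp_def)
    also have "\<dots> = distr L borel (\<lambda>w. S w - m')"
      using L(3) by (intro distr_cong_AE) (auto simp: inner)
    also have "\<dots> = distr (distr L borel S) borel (\<lambda>x. x - m')"
      by (subst distr_distr) (auto simp: comp_def)
    also have "\<dots> = normal_law 0 s"
      using s by (simp add: distr_normal_law_centre)
    finally show "\<exists>s\<ge>0. distr C borel (\<lambda>x. t \<bullet> x) = normal_law 0 s" using s(1) by blast
  qed
  fix i j
  have eq: "(LINT x|C. x $ i * x $ j) = (LINT w|L. (w $ i - m $ i) * (w $ j - m $ j))"
    unfolding C_def by (subst integral_distr) auto
  show "(LINT x|C. x $ i * x $ j) \<ge> 0"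
  proof (cases "i = k \<or> j = k")
    case True
    have "(LINT w|L. (w $ i - m $ i) * (w $ j - m $ j)) = (LINT w|L. 0)"
      using L(3) True by (intro integral_cong_AE) (auto simp: m_def)
    then show ?thesis unfolding eq by simp
  next
    case False
    then have "(LINT w|L. (w $ i - m $ i) * (w $ j - m $ j)) = covariance L (\<lambda>w. w $ i) (\<lambda>w. w $ j)"
      by (simp add: covariance_def mean m_def)
    also have "\<dots> = \<Sigma> i j" using G False by (auto simp: gaussian_vector_def)
    finally show ?thesis unfolding eq using \<Sigma> by simp
  qed
qed

section \<open>Covariances of smooth increasing functions of a Gaussian vector\<close>

text \<open>Bounded functions whose gradient is bounded, lies in the positive orthant and is Lipschitz.
  This is stated through a second-order Taylor estimate with a uniform constant, because that is what the small-scale expansion of the covariance consumes.\<close>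

definition smoothly_increasing :: "(real ^ 'd \<Rightarrow> real) \<Rightarrow> bool" where
  "smoothly_increasing f \<longleftrightarrow>
     (\<exists>C. \<forall>x. \<bar>f x\<bar> \<le> C \<and>
        (\<exists>v. (\<forall>i. 0 \<le> v $ i) \<and> norm v \<le> C \<and>
             (\<forall>h. \<bar>f (x + h) - f x - v \<bullet> h\<bar> \<le> C * (norm h)\<^sup>2)))"

lemma smoothly_increasing_borel:
  assumes "smoothly_increasing f"
  shows "f \<in> borel_measurable borel"
proof -
  obtain C where C: "\<And>x. \<bar>f x\<bar> \<le> C" "\<And>x. \<exists>v. norm v \<le> C \<and> (\<forall>h. \<bar>f (x + h) - f x - v \<bullet> h\<bar> \<le> C * (norm h)\<^sup>2)"
    using assms unfolding smoothly_increasing_def by metis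
  have "isCont f x" for x
  proof -
    obtain v where v: "norm v \<le> C" "\<And>h. \<bar>f (x + h) - f x - v \<bullet> h\<bar> \<le> C * (norm h)\<^sup>2"
      using C(2) by blast
    have bound: "norm (f (x + h) - f x) \<le> C * norm h + C * (norm h)\<^sup>2" for h
    proof -
      have "\<bar>v \<bullet> h\<bar> \<le> C * norm h"
        using Cauchy_Schwarz_ineq2[of v h] mult_right_mono[OF v(1), of "norm h"] by simp
      then show ?thesis using v(2)[of h] by (simp add: abs_le_iff)
    qed
    have "(\<lambda>h. f (x + h) - f x) \<midarrow>0\<rightarrow> 0"
    proof (rule Lim_null_comparison)
      show "\<forall>\<^sub>F h in at 0. norm (f (x + h) - f x) \<le> C * norm h + C * (norm h)\<^sup>2"
        using bound by simp
      show "((\<lambda>h. C * norm h + C * (norm h)\<^sup>2) \<longlongrightarrow> 0) (at 0)"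
        by (auto intro!: tendsto_eq_intros)
    qed
    then show ?thesis by (simp add: isCont_iff LIM_zero_iff)
  qed
  then show ?thesis
    by (intro borel_measurable_continuous_onI) (auto simp: continuous_at_imp_continuous_on)
qed

text \<open>To first order, \<open>f (a + s x)\<close> is \<open>f a + s (v \<bullet> x)\<close> and \<open>g (b + s x)\<close> is \<open>g b + s (w \<bullet> x)\<close>, so the
  covariance is \<open>s\<^sup>2\<close> times the sum of \<open>v\<^sub>i w\<^sub>j E (x\<^sub>i x\<^sub>j)\<close>, which is nonnegative, up to terms of order
  \<open>s\<^sup>3\<close>.  Different base points \<open>a\<close> and \<open>b\<close> are essential: the doubling step translates them
  independently.\<close>

lemma small_scale_covariance:
  fixes \<mu> :: "(real ^ 'd) measure"
  assumes \<mu>: "centred_gaussian \<mu>" "\<And>i j. (LINT x|\<mu>. x $ i * x $ j) \<ge> 0"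
    and f: "smoothly_increasing f" and g: "smoothly_increasing g"
  shows "\<exists>K. \<forall>s a b. 0 < s \<longrightarrow> s \<le> 1 \<longrightarrow>
     (LINT x|\<mu>. f (a + s *\<^sub>R x)) * (LINT x|\<mu>. g (b + s *\<^sub>R x)) - K * s ^ 3
       \<le> (LINT x|\<mu>. f (a + s *\<^sub>R x) * g (b + s *\<^sub>R x))"
proof -
  interpret prob_space \<mu> using \<mu> by (simp add: centred_gaussian_def)
  have [measurable_cong]: "sets \<mu> = sets borel" using \<mu> by (simp add: centred_gaussian_def)
  note [measurable] = smoothly_increasing_borel[OF f] smoothly_increasing_borel[OF g]
  obtain Cf where Cf: "\<And>x. \<bar>f x\<bar> \<le> Cf"
    "\<And>x. \<exists>v. (\<forall>i. 0 \<le> v $ i) \<and> norm v \<le> Cf \<and> (\<forall>h. \<bar>f (x + h) - f x - v \<bullet> h\<bar> \<le> Cf * (norm h)\<^sup>2)"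
    using f unfolding smoothly_increasing_def by metis
  obtain Cg where Cg: "\<And>x. \<bar>g x\<bar> \<le> Cg"
    "\<And>x. \<exists>v. (\<forall>i. 0 \<le> v $ i) \<and> norm v \<le> Cg \<and> (\<forall>h. \<bar>g (x + h) - g x - v \<bullet> h\<bar> \<le> Cg * (norm h)\<^sup>2)"
    using g unfolding smoothly_increasing_def by metis
  have C0: "0 \<le> Cf" "0 \<le> Cg" using Cf(1)[of 0] Cg(1)[of 0] by auto
  define D where "D x = 1 + norm x ^ 4" for x :: "real ^ 'd"
  have [measurable]: "D \<in> borel_measurable borel" unfolding D_def by measurable
  have Di: "integrable \<mu> D"
    unfolding D_def using centred_gaussian_norm_power4[OF \<mu>(1)] by simp
  have D: "norm x ^ n \<le> D x" if "n \<le> 4" for x :: "real ^ 'd" and n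
  proof (cases "norm x \<le> 1")
    case True
    then have "norm x ^ n \<le> 1" by (simp add: power_le_one)
    also have "1 \<le> D x" by (simp add: D_def)
    finally show ?thesis .
  next
    case False
    then have "norm x ^ n \<le> norm x ^ 4" using that by (intro power_increasing) auto
    then show ?thesis by (simp add: D_def)
  qed
  define m where "m = integral\<^sup>L \<mu> D"
  have dominated: "integrable \<mu> h" "\<bar>integral\<^sup>L \<mu> h\<bar> \<le> c * m"
    if [measurable]: "h \<in> borel_measurable borel" and h: "\<And>x. \<bar>h x\<bar> \<le> c * D x" for h c
  proof -
    have "norm (h x) \<le> norm (c * D x)" for x
      using order_trans[OF h[of x] abs_ge_self] by simp
    then show i: "integrable \<mu> h"
      by (intro Bochner_Integration.integrable_bound[OF integrable_mult_right[OF Di, of c]]) auto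
    have "\<bar>integral\<^sup>L \<mu> h\<bar> \<le> (LINT x|\<mu>. \<bar>h x\<bar>)" by (rule integral_abs_bound)
    also have "\<dots> \<le> (LINT x|\<mu>. c * D x)"
      using h i Di by (intro integral_mono) auto
    finally show "\<bar>integral\<^sup>L \<mu> h\<bar> \<le> c * m" by (simp add: m_def)
  qed
  have coordi: "integrable \<mu> (\<lambda>x. x $ i)" for i
  proof (rule dominated(1)[of _ 1])
    show "\<bar>x $ i\<bar> \<le> 1 * D x" for x :: "real ^ 'd"
      using component_le_norm_cart[of x i] D[of 1 x] by simp
  qed measurable
  have prodi: "integrable \<mu> (\<lambda>x. x $ i * x $ j)" for i j
  proof (rule dominated(1)[of _ 1])
    fix x :: "real ^ 'd"
    have "\<bar>x $ i * x $ j\<bar> \<le> norm x * norm x"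
      unfolding abs_mult by (intro mult_mono component_le_norm_cart) auto
    also have "\<dots> \<le> 1 * D x" using D[of 2 x] by (simp add: power2_eq_square)
    finally show "\<bar>x $ i * x $ j\<bar> \<le> 1 * D x" .
  qed measurable
  define K where "K = 3 * (Cf * Cg) * m + Cf * Cg * m\<^sup>2"
  have "(LINT x|\<mu>. f (a + s *\<^sub>R x)) * (LINT x|\<mu>. g (b + s *\<^sub>R x)) - K * s ^ 3
       \<le> (LINT x|\<mu>. f (a + s *\<^sub>R x) * g (b + s *\<^sub>R x))" if s: "0 < s" "s \<le> 1" for s a b
  proof -
    obtain v where v: "\<And>i. 0 \<le> v $ i" "norm v \<le> Cf" "\<And>h. \<bar>f (a + h) - f a - v \<bullet> h\<bar> \<le> Cf * (norm h)\<^sup>2"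
      using Cf(2) by blast
    obtain w where w: "\<And>i. 0 \<le> w $ i" "norm w \<le> Cg" "\<And>h. \<bar>g (b + h) - g b - w \<bullet> h\<bar> \<le> Cg * (norm h)\<^sup>2"
      using Cg(2) by blast
    define r where "r x = f (a + s *\<^sub>R x) - f a - s * (v \<bullet> x)" for x
    define q where "q x = g (b + s *\<^sub>R x) - g b - s * (w \<bullet> x)" for x
    have [measurable]: "r \<in> borel_measurable borel" "q \<in> borel_measurable borel"
      unfolding r_def q_def by measurable
    have r: "\<bar>r x\<bar> \<le> Cf * s\<^sup>2 * (norm x)\<^sup>2" and q: "\<bar>q x\<bar> \<le> Cg * s\<^sup>2 * (norm x)\<^sup>2" for x
      using v(3)[of "s *\<^sub>R x"] w(3)[of "s *\<^sub>R x"] by (simp_all add: r_def q_def power_mult_distrib)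
    have vx: "\<bar>v \<bullet> x\<bar> \<le> Cf * norm x" and wx: "\<bar>w \<bullet> x\<bar> \<le> Cg * norm x" for x
      using Cauchy_Schwarz_ineq2[of v x] mult_right_mono[OF v(2), of "norm x"]
        Cauchy_Schwarz_ineq2[of w x] mult_right_mono[OF w(2), of "norm x"] by simp_all
    have inner_sum: "v \<bullet> x = (\<Sum>i\<in>UNIV. v $ i * x $ i)" for v x :: "real ^ 'd"
      by (simp add: inner_vec_def)
    have inneri: "integrable \<mu> (\<lambda>x. v \<bullet> x)" "(LINT x|\<mu>. v \<bullet> x) = 0" for v :: "real ^ 'd"
      unfolding inner_sum using coordi centred_gaussian_coordinate(1)[OF \<mu>(1)]
      by (auto simp: Bochner_Integration.integral_sum)
    have inner_prod: "(v \<bullet> x) * (w \<bullet> x) = (\<Sum>i\<in>UNIV. \<Sum>j\<in>UNIV. v $ i * w $ j * (x $ i * x $ j))" for x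
      unfolding inner_sum sum_product by (simp add: algebra_simps)
    have vwi: "integrable \<mu> (\<lambda>x. (v \<bullet> x) * (w \<bullet> x))"
      unfolding inner_prod by (intro Bochner_Integration.integrable_sum integrable_mult_right prodi)
    have "(LINT x|\<mu>. (v \<bullet> x) * (w \<bullet> x)) = (\<Sum>i\<in>UNIV. \<Sum>j\<in>UNIV. v $ i * w $ j * (LINT x|\<mu>. x $ i * x $ j))"
      unfolding inner_prod using prodi by (simp add: Bochner_Integration.integral_sum)
    also have "\<dots> \<ge> 0" using v(1) w(1) \<mu>(2) by (intro sum_nonneg mult_nonneg_nonneg) auto
    finally have vw: "(LINT x|\<mu>. (v \<bullet> x) * (w \<bullet> x)) \<ge> 0" .
    have rD: "\<bar>r x\<bar> \<le> (Cf * s\<^sup>2) * D x" and qD: "\<bar>q x\<bar> \<le> (Cg * s\<^sup>2) * D x" for x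
      using r[of x] q[of x] D[of 2 x] C0 mult_left_mono[of "(norm x)\<^sup>2" "D x" "Cf * s\<^sup>2"]
        mult_left_mono[of "(norm x)\<^sup>2" "D x" "Cg * s\<^sup>2"] by auto
    have ri: "integrable \<mu> r" and ir: "\<bar>integral\<^sup>L \<mu> r\<bar> \<le> Cf * s\<^sup>2 * m"
      using dominated[of r, OF _ rD] by simp_all
    have qi: "integrable \<mu> q" and iq: "\<bar>integral\<^sup>L \<mu> q\<bar> \<le> Cg * s\<^sup>2 * m"
      using dominated[of q, OF _ qD] by simp_all
    have fi: "integrable \<mu> (\<lambda>x. f (a + s *\<^sub>R x))" and gi: "integrable \<mu> (\<lambda>x. g (b + s *\<^sub>R x))"
      by (rule integrable_const_bound[where B=Cf] integrable_const_bound[where B=Cg]; simp add: Cf(1) Cg(1))+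
    have fgi: "integrable \<mu> (\<lambda>x. f (a + s *\<^sub>R x) * g (b + s *\<^sub>R x))"
    proof (rule integrable_const_bound[where B="Cf * Cg"])
      show "AE x in \<mu>. norm (f (a + s *\<^sub>R x) * g (b + s *\<^sub>R x)) \<le> Cf * Cg"
        using C0 Cf(1) Cg(1) by (intro AE_I2) (auto simp: abs_mult intro!: mult_mono)
    qed measurable
    define R where "R x = s * (v \<bullet> x) * q x + s * (w \<bullet> x) * r x + r x * q x" for x
    have [measurable]: "R \<in> borel_measurable borel" unfolding R_def by measurable
    have R: "\<bar>R x\<bar> \<le> 3 * (Cf * Cg) * s ^ 3 * D x" for x
    proof -
      have "\<bar>s * (v \<bullet> x) * q x\<bar> \<le> (s * (Cf * norm x)) * (Cg * s\<^sup>2 * (norm x)\<^sup>2)"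
        unfolding abs_mult using s C0 vx[of x] q[of x] by (intro mult_mono) auto
      also have "\<dots> = (Cf * Cg) * s ^ 3 * norm x ^ 3" by (simp add: power2_eq_square power3_eq_cube)
      finally have 1: "\<bar>s * (v \<bullet> x) * q x\<bar> \<le> (Cf * Cg) * s ^ 3 * norm x ^ 3" .
      have "\<bar>s * (w \<bullet> x) * r x\<bar> \<le> (s * (Cg * norm x)) * (Cf * s\<^sup>2 * (norm x)\<^sup>2)"
        unfolding abs_mult using s C0 wx[of x] r[of x] by (intro mult_mono) auto
      also have "\<dots> = (Cf * Cg) * s ^ 3 * norm x ^ 3" by (simp add: power2_eq_square power3_eq_cube)
      finally have 2: "\<bar>s * (w \<bullet> x) * r x\<bar> \<le> (Cf * Cg) * s ^ 3 * norm x ^ 3" .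
      have "\<bar>r x * q x\<bar> \<le> (Cf * s\<^sup>2 * (norm x)\<^sup>2) * (Cg * s\<^sup>2 * (norm x)\<^sup>2)"
        unfolding abs_mult using s C0 q[of x] r[of x] by (intro mult_mono) auto
      also have "\<dots> = (Cf * Cg) * s ^ 4 * norm x ^ 4"
        by (simp add: power2_eq_square power4_eq_xxxx)
      also have "\<dots> \<le> (Cf * Cg) * s ^ 3 * norm x ^ 4"
        using s C0 by (intro mult_right_mono mult_left_mono power_decreasing) auto
      finally have 3: "\<bar>r x * q x\<bar> \<le> (Cf * Cg) * s ^ 3 * norm x ^ 4" .
      have "(Cf * Cg) * s ^ 3 * norm x ^ 3 \<le> (Cf * Cg) * s ^ 3 * D x"
        "(Cf * Cg) * s ^ 3 * norm x ^ 4 \<le> (Cf * Cg) * s ^ 3 * D x"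
        using s C0 D by (auto intro!: mult_left_mono)
      then show ?thesis using 1 2 3 unfolding R_def by (simp add: abs_le_iff)
    qed
    have Ri: "integrable \<mu> R" and iR: "\<bar>integral\<^sup>L \<mu> R\<bar> \<le> 3 * (Cf * Cg) * s ^ 3 * m"
      using dominated[of R, OF _ R] by simp_all
    have f_eq: "(LINT x|\<mu>. f (a + s *\<^sub>R x)) = f a + integral\<^sup>L \<mu> r"
      unfolding r_def using fi inneri[of v] by (simp add: prob_space)
    have g_eq: "(LINT x|\<mu>. g (b + s *\<^sub>R x)) = g b + integral\<^sup>L \<mu> q"
      unfolding q_def using gi inneri[of w] by (simp add: prob_space)
    have pw: "f (a + s *\<^sub>R x) * g (b + s *\<^sub>R x) =
        f a * g (b + s *\<^sub>R x) + g b * f (a + s *\<^sub>R x) - f a * g b + s\<^sup>2 * ((v \<bullet> x) * (w \<bullet> x)) + R x" for x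
      unfolding R_def r_def q_def by (simp add: algebra_simps power2_eq_square)
    have "(LINT x|\<mu>. f (a + s *\<^sub>R x) * g (b + s *\<^sub>R x)) =
        f a * (LINT x|\<mu>. g (b + s *\<^sub>R x)) + g b * (LINT x|\<mu>. f (a + s *\<^sub>R x)) - f a * g b
         + s\<^sup>2 * (LINT x|\<mu>. (v \<bullet> x) * (w \<bullet> x)) + integral\<^sup>L \<mu> R"
      unfolding pw using fi gi vwi Ri by (simp add: prob_space)
    then have eq: "(LINT x|\<mu>. f (a + s *\<^sub>R x) * g (b + s *\<^sub>R x)) -
        (LINT x|\<mu>. f (a + s *\<^sub>R x)) * (LINT x|\<mu>. g (b + s *\<^sub>R x)) =
        s\<^sup>2 * (LINT x|\<mu>. (v \<bullet> x) * (w \<bullet> x)) + integral\<^sup>L \<mu> R - integral\<^sup>L \<mu> r * integral\<^sup>L \<mu> q"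
      unfolding f_eq g_eq by (simp add: algebra_simps)
    have "integral\<^sup>L \<mu> r * integral\<^sup>L \<mu> q \<le> \<bar>integral\<^sup>L \<mu> r\<bar> * \<bar>integral\<^sup>L \<mu> q\<bar>"
      by (metis abs_ge_self abs_mult)
    also have "\<dots> \<le> (Cf * s\<^sup>2 * m) * (Cg * s\<^sup>2 * m)"
      using ir iq by (intro mult_mono) auto
    also have "\<dots> = Cf * Cg * m\<^sup>2 * s ^ 4" by (simp add: power2_eq_square power4_eq_xxxx)
    also have "\<dots> \<le> Cf * Cg * m\<^sup>2 * s ^ 3"
      using s C0 by (intro mult_left_mono power_decreasing) auto
    finally have "integral\<^sup>L \<mu> r * integral\<^sup>L \<mu> q \<le> Cf * Cg * m\<^sup>2 * s ^ 3" .
    then show ?thesis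
      using eq iR mult_nonneg_nonneg[OF zero_le_power2[of s] vw] by (simp add: K_def algebra_simps)
  qed
  then show ?thesis by blast
qed

text \<open>With \<open>F\<close> and \<open>G\<close> the averages of \<open>f\<close> and \<open>g\<close> over \<open>y\<close>, the hypothesis at the base points \<open>a + x\<close>, \<open>b + x\<close>
  replaces the joint average over \<open>y\<close> by \<open>F (a + x) * G (b + x)\<close>.  Writing the latter with two
  independent copies \<open>y\<close>, \<open>y'\<close>, the hypothesis at the base points \<open>a + y\<close>, \<open>b + y'\<close> then decouples
  \<open>x\<close>.  Each step costs \<open>c\<close>.  The hypothesis is applied to \<open>f\<close> and \<open>g\<close> themselves, never to \<open>F\<close> and \<open>G\<close>, so
  the constant does not deteriorate under iteration.\<close>

lemma covariance_convolution:
  fixes \<nu> :: "(real ^ 'd) measure" and f g :: "real ^ 'd \<Rightarrow> real"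
  assumes \<nu>: "prob_space \<nu>" "sets \<nu> = sets borel"
    and meas[measurable]: "f \<in> borel_measurable borel" "g \<in> borel_measurable borel"
    and bound: "\<And>x. \<bar>f x\<bar> \<le> C" "\<And>x. \<bar>g x\<bar> \<le> C"
    and cov: "\<And>a b. (LINT x|\<nu>. f (a + x)) * (LINT x|\<nu>. g (b + x)) - c \<le> (LINT x|\<nu>. f (a + x) * g (b + x))"
  shows "(LINT x|\<nu>. LINT y|\<nu>. f (a + x + y)) * (LINT x|\<nu>. LINT y|\<nu>. g (b + x + y)) - 2 * c
    \<le> (LINT x|\<nu>. LINT y|\<nu>. f (a + x + y) * g (b + x + y))"
proof -
  interpret prob_space \<nu> by fact
  interpret P: pair_prob_space \<nu> \<nu> ..
  note [measurable_cong] = \<nu>(2)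
  have C0: "C \<ge> 0" using bound(1)[of 0] by simp
  have bound_int: "integrable \<nu> h" if [measurable]: "h \<in> borel_measurable borel" and "\<And>x. \<bar>h x\<bar> \<le> B"
    for h :: "_ \<Rightarrow> real" and B
    using that(2) by (intro integrable_const_bound[where B=B]) auto
  have int_bound: "\<bar>integral\<^sup>L \<nu> h\<bar> \<le> B" if "h \<in> borel_measurable borel" and h: "\<And>x. \<bar>h x\<bar> \<le> B"
    for h :: "_ \<Rightarrow> real" and B
  proof -
    have "h x \<le> B" "- B \<le> h x" for x using h[of x] by linarith+
    then have "integral\<^sup>L \<nu> h \<le> B" "- B \<le> integral\<^sup>L \<nu> h"
      using integral_le_const[OF bound_int[OF that], of B] integral_ge_const[OF bound_int[OF that], of "- B"]
      by simp_all
    then show ?thesis by linarith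
  qed
  have prod_bound: "\<bar>p * q\<bar> \<le> C * C" if "\<bar>p\<bar> \<le> C" "\<bar>q\<bar> \<le> C" for p q :: real
    using that C0 by (auto simp: abs_mult intro!: mult_mono)
  have swap: "(LINT x|\<nu>. LINT y|\<nu>. h x y) = (LINT y|\<nu>. LINT x|\<nu>. h x y)"
    if [measurable]: "case_prod h \<in> borel_measurable (borel \<Otimes>\<^sub>M borel)" and "\<And>x y. \<bar>h x y\<bar> \<le> C * C"
    for h :: "_ \<Rightarrow> _ \<Rightarrow> real"
    using that(2) by (intro P.Fubini_integral[symmetric] P.integrable_const_bound[where B="C * C"]) auto
  define F where "F z = (LINT y|\<nu>. f (z + y))" for z
  define G where "G z = (LINT y|\<nu>. g (z + y))" for z
  have [measurable]: "F \<in> borel_measurable borel" "G \<in> borel_measurable borel"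
    unfolding F_def G_def by measurable
  have FG: "\<bar>F z\<bar> \<le> C" "\<bar>G z\<bar> \<le> C" for z
    unfolding F_def G_def using bound by (auto intro!: int_bound)
  have "(LINT x|\<nu>. F (a + x)) * (LINT y|\<nu>. G (b + y)) - c = (LINT y|\<nu>. LINT y'|\<nu>. F (a + y) * G (b + y') - c)"
  proof -
    have "integrable \<nu> (\<lambda>y. F (a + y))" "integrable \<nu> (\<lambda>y. G (b + y))"
      using FG by (auto intro!: bound_int)
    then show ?thesis by (simp add: prob_space)
  qed
  also have "\<dots> \<le> (LINT y|\<nu>. LINT y'|\<nu>. LINT x|\<nu>. f (a + x + y) * g (b + x + y'))"
  proof (intro integral_mono)
    fix y y'
    show "F (a + y) * G (b + y') - c \<le> (LINT x|\<nu>. f (a + x + y) * g (b + x + y'))"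
      using cov[of "a + y" "b + y'"] unfolding F_def G_def by (simp add: algebra_simps)
  next
    fix y
    have FGc: "\<bar>F (a + y) * G (b + y') - c\<bar> \<le> C * C + \<bar>c\<bar>" for y y'
      using prod_bound[OF FG, of "a + y" "b + y'"] by linarith
    show "integrable \<nu> (\<lambda>y'. F (a + y) * G (b + y') - c)"
      using FGc by (intro bound_int) auto
    show "integrable \<nu> (\<lambda>y'. LINT x|\<nu>. f (a + x + y) * g (b + x + y'))"
      using bound prod_bound by (intro bound_int[of _ "C * C"] int_bound) auto
    show "integrable \<nu> (\<lambda>y. LINT y'|\<nu>. F (a + y) * G (b + y') - c)"
      using FGc by (intro bound_int[of _ "C * C + \<bar>c\<bar>"] int_bound) auto
    show "integrable \<nu> (\<lambda>y. LINT y'|\<nu>. LINT x|\<nu>. f (a + x + y) * g (b + x + y'))"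
      using bound prod_bound by (intro bound_int[of _ "C * C"] int_bound) auto
  qed
  also have "\<dots> = (LINT y|\<nu>. LINT x|\<nu>. LINT y'|\<nu>. f (a + x + y) * g (b + x + y'))"
    using bound prod_bound
    by (intro Bochner_Integration.integral_cong refl swap) auto
  also have "\<dots> = (LINT y|\<nu>. LINT x|\<nu>. f (a + x + y) * G (b + x))"
    by (simp add: G_def)
  also have "\<dots> = (LINT x|\<nu>. LINT y|\<nu>. f (a + x + y) * G (b + x))"
    using bound prod_bound FG by (intro swap) auto
  also have "\<dots> = (LINT x|\<nu>. F (a + x) * G (b + x))"
    by (simp add: F_def)
  also have "\<dots> = (LINT x|\<nu>. F (a + x) * G (b + x) - c) + c"
  proof -
    have "integrable \<nu> (\<lambda>x. F (a + x) * G (b + x))"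
      using FG prod_bound by (intro bound_int) auto
    then show ?thesis by (simp add: prob_space)
  qed
  also have "(LINT x|\<nu>. F (a + x) * G (b + x) - c) \<le> (LINT x|\<nu>. LINT y|\<nu>. f (a + x + y) * g (b + x + y))"
  proof (intro integral_mono)
    fix x show "F (a + x) * G (b + x) - c \<le> (LINT y|\<nu>. f (a + x + y) * g (b + x + y))"
      using cov[of "a + x" "b + x"] by (simp add: F_def G_def)
  next
    show "integrable \<nu> (\<lambda>x. F (a + x) * G (b + x) - c)"
    proof (rule Bochner_Integration.integrable_diff)
      show "integrable \<nu> (\<lambda>x. F (a + x) * G (b + x))"
        using FG prod_bound by (intro bound_int[of _ "C * C"]) auto
    qed simp
    show "integrable \<nu> (\<lambda>x. LINT y|\<nu>. f (a + x + y) * g (b + x + y))"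
      using bound prod_bound by (intro bound_int[of _ "C * C"] int_bound) auto
  qed
  finally show ?thesis by (simp add: F_def G_def)
qed

lemma covariance_doubling:
  fixes \<mu> :: "(real ^ 'd) measure" and f g :: "real ^ 'd \<Rightarrow> real"
  assumes \<mu>: "centred_gaussian \<mu>"
    and meas[measurable]: "f \<in> borel_measurable borel" "g \<in> borel_measurable borel"
    and bound: "\<And>x. \<bar>f x\<bar> \<le> C" "\<And>x. \<bar>g x\<bar> \<le> C"
    and cov: "\<And>a b. (LINT x|\<mu>. f (a + s *\<^sub>R x)) * (LINT x|\<mu>. g (b + s *\<^sub>R x)) - c
      \<le> (LINT x|\<mu>. f (a + s *\<^sub>R x) * g (b + s *\<^sub>R x))"
  shows "(LINT x|\<mu>. f (a + (sqrt 2 * s) *\<^sub>R x)) * (LINT x|\<mu>. g (b + (sqrt 2 * s) *\<^sub>R x)) - 2 * c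
      \<le> (LINT x|\<mu>. f (a + (sqrt 2 * s) *\<^sub>R x) * g (b + (sqrt 2 * s) *\<^sub>R x))"
proof -
  interpret prob_space \<mu> using \<mu> by (simp add: centred_gaussian_def)
  interpret P: pair_prob_space \<mu> \<mu> ..
  have [measurable_cong]: "sets \<mu> = sets borel" using \<mu> by (simp add: centred_gaussian_def)
  have C0: "C \<ge> 0" using bound(1)[of 0] by simp
  define \<nu> where "\<nu> = distr \<mu> borel (\<lambda>x. s *\<^sub>R x)"
  have \<nu>: "prob_space \<nu>" "sets \<nu> = sets borel"
    unfolding \<nu>_def by (auto intro!: prob_space_distr)
  have \<nu>_int: "(LINT x|\<nu>. h x) = (LINT x|\<mu>. h (s *\<^sub>R x))" if [measurable]: "h \<in> borel_measurable borel"
    for h :: "_ \<Rightarrow> real"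
    unfolding \<nu>_def by (subst integral_distr) auto
  have conv: "(LINT x|\<nu>. LINT y|\<nu>. h (a + x + y)) = (LINT x|\<mu>. h (a + (sqrt 2 * s) *\<^sub>R x))"
    if [measurable]: "h \<in> borel_measurable borel" and h: "\<And>x. \<bar>h x\<bar> \<le> B" for h :: "_ \<Rightarrow> real" and B a
  proof -
    interpret \<nu>: prob_space \<nu> by (rule \<nu>)
    note [measurable_cong] = \<nu>(2)
    have "(LINT x|\<nu>. LINT y|\<nu>. h (a + x + y)) = (LINT x|\<mu>. LINT y|\<nu>. h (a + s *\<^sub>R x + y))"
      by (subst \<nu>_int) auto
    also have "\<dots> = (LINT x|\<mu>. LINT y|\<mu>. h (a + s *\<^sub>R x + s *\<^sub>R y))"
      by (subst \<nu>_int) auto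
    also have "\<dots> = (LINT z|(\<mu> \<Otimes>\<^sub>M \<mu>). (case z of (x, y) \<Rightarrow> h (a + s *\<^sub>R x + s *\<^sub>R y)))"
      using h by (intro P.integral_fst P.integrable_const_bound[where B=B]) auto
    also have "\<dots> = (LINT z|distr (\<mu> \<Otimes>\<^sub>M \<mu>) borel (\<lambda>(x, y). x + y). h (a + s *\<^sub>R z))"
      by (subst integral_distr) (auto intro!: Bochner_Integration.integral_cong simp: algebra_simps)
    also have "\<dots> = (LINT x|\<mu>. h (a + (sqrt 2 * s) *\<^sub>R x))"
      unfolding centred_gaussian_stable[OF \<mu>] by (subst integral_distr) (auto simp: mult.commute)
    finally show ?thesis .
  qed
  have ab: "b + x + y = (a + x + y) + (b - a)" for x y by simp
  have fg: "\<bar>f x * g (x + (b - a))\<bar> \<le> C * C" for x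
    using bound C0 by (auto simp: abs_mult intro!: mult_mono)
  have "(LINT x|\<nu>. LINT y|\<nu>. f (a + x + y)) * (LINT x|\<nu>. LINT y|\<nu>. g (b + x + y)) - 2 * c
    \<le> (LINT x|\<nu>. LINT y|\<nu>. f (a + x + y) * g (b + x + y))"
    using cov by (intro covariance_convolution[OF \<nu> meas bound]) (simp_all add: \<nu>_int)
  also have "(LINT x|\<nu>. LINT y|\<nu>. f (a + x + y) * g (b + x + y)) =
      (LINT x|\<nu>. LINT y|\<nu>. (\<lambda>z. f z * g (z + (b - a))) (a + x + y))"
    unfolding ab by simp
  also have "\<dots> = (LINT x|\<mu>. f (a + (sqrt 2 * s) *\<^sub>R x) * g (b + (sqrt 2 * s) *\<^sub>R x))"
    by (subst conv[OF _ fg]) (auto simp: algebra_simps)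
  finally show ?thesis
    by (simp only: conv[OF meas(1) bound(1)] conv[OF meas(2) bound(2)])
qed

text \<open>Start at scale \<open>2 powr (- m / 2)\<close> with error \<open>K * 2 powr (- 3 * m / 2)\<close> and double \<open>m\<close> times: the
  error at scale \<open>1\<close> is \<open>K * 2 powr (- m / 2)\<close>, which tends to \<open>0\<close>.\<close>

lemma gaussian_covariance_nonneg_smooth:
  fixes \<mu> :: "(real ^ 'd) measure"
  assumes \<mu>: "centred_gaussian \<mu>" "\<And>i j. (LINT x|\<mu>. x $ i * x $ j) \<ge> 0"
    and f: "smoothly_increasing f" and g: "smoothly_increasing g"
  shows "(LINT x|\<mu>. f (a + x)) * (LINT x|\<mu>. g (a + x)) \<le> (LINT x|\<mu>. f (a + x) * g (a + x))"
proof -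
  note [measurable] = smoothly_increasing_borel[OF f] smoothly_increasing_borel[OF g]
  obtain C where C: "\<And>x. \<bar>f x\<bar> \<le> C" "\<And>x. \<bar>g x\<bar> \<le> C"
  proof -
    obtain Cf Cg where "\<And>x. \<bar>f x\<bar> \<le> Cf" "\<And>x. \<bar>g x\<bar> \<le> Cg"
      using f g unfolding smoothly_increasing_def by metis
    then show ?thesis using that[of "max Cf Cg"] by (meson max.coboundedI1 max.coboundedI2)
  qed
  obtain K where K: "\<And>s a b. 0 < s \<Longrightarrow> s \<le> 1 \<Longrightarrow>
     (LINT x|\<mu>. f (a + s *\<^sub>R x)) * (LINT x|\<mu>. g (b + s *\<^sub>R x)) - K * s ^ 3
       \<le> (LINT x|\<mu>. f (a + s *\<^sub>R x) * g (b + s *\<^sub>R x))"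
    using small_scale_covariance[OF \<mu> f g] by blast
  define t where "t = 1 / sqrt 2"
  have t: "0 < t" "t < 1" "sqrt 2 * t = 1" "2 * t ^ 2 = 1"
    by (simp_all add: t_def power_divide real_less_rsqrt)
  have iterate: "(LINT x|\<mu>. f (a + t ^ n *\<^sub>R x)) * (LINT x|\<mu>. g (b + t ^ n *\<^sub>R x)) - 2 ^ m * (K * (t ^ (n + m)) ^ 3)
      \<le> (LINT x|\<mu>. f (a + t ^ n *\<^sub>R x) * g (b + t ^ n *\<^sub>R x))" for n m a b
  proof (induction m arbitrary: n a b)
    case 0
    then show ?case using K[of "t ^ n" a b] t by (simp add: power_le_one)
  next
    case (Suc m)
    have *: "sqrt 2 * t ^ Suc n = t ^ n" for n using t(3) by (metis mult.assoc mult_1 power_Suc)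
    have "(LINT x|\<mu>. f (a + (sqrt 2 * t ^ Suc n) *\<^sub>R x)) * (LINT x|\<mu>. g (b + (sqrt 2 * t ^ Suc n) *\<^sub>R x))
        - 2 * (2 ^ m * (K * (t ^ (Suc n + m)) ^ 3))
      \<le> (LINT x|\<mu>. f (a + (sqrt 2 * t ^ Suc n) *\<^sub>R x) * g (b + (sqrt 2 * t ^ Suc n) *\<^sub>R x))"
      by (rule covariance_doubling[OF \<mu>(1) _ _ C Suc.IH]) measurable
    then show ?case unfolding * by simp
  qed
  have "(LINT x|\<mu>. f (a + x)) * (LINT x|\<mu>. g (a + x)) - K * t ^ m \<le> (LINT x|\<mu>. f (a + x) * g (a + x))" for m
  proof -
    have "2 ^ m * (K * (t ^ m) ^ 3) = K * ((2 * t ^ 2) ^ m * t ^ m)"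
      by (simp add: power_mult_distrib power2_eq_square power3_eq_cube)
    also have "\<dots> = K * t ^ m" using t(4) by simp
    finally have eq: "2 ^ m * (K * (t ^ m) ^ 3) = K * t ^ m" .
    have "(LINT x|\<mu>. f (a + x)) * (LINT x|\<mu>. g (a + x)) - 2 ^ m * (K * (t ^ m) ^ 3)
        \<le> (LINT x|\<mu>. f (a + x) * g (a + x))"
      using iterate[where n=0 and m=m and a=a and b=a] by simp
    then show ?thesis unfolding eq .
  qed
  moreover have "(\<lambda>m. (LINT x|\<mu>. f (a + x)) * (LINT x|\<mu>. g (a + x)) - K * t ^ m)
      \<longlonglongrightarrow> (LINT x|\<mu>. f (a + x)) * (LINT x|\<mu>. g (a + x)) - K * 0"
    using t by (intro tendsto_intros LIMSEQ_power_zero) auto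
  ultimately show ?thesis
    using LIMSEQ_le_const2 by fastforce
qed

section \<open>Smoothing of increasing functions\<close>

text \<open>A compactly supported kernel that is just smooth enough: \<open>(max 0 (1 - r))\<^sup>2\<close> has Lipschitz derivative,
  so the kernel has a second-order Taylor estimate.\<close>

definition bump :: "real ^ 'd \<Rightarrow> real" where
  "bump z = (max 0 (1 - (norm z)\<^sup>2))\<^sup>2"

definition bump_grad :: "real ^ 'd \<Rightarrow> real ^ 'd" where
  "bump_grad z = (- 4 * max 0 (1 - (norm z)\<^sup>2)) *\<^sub>R z"

lemma bump_measurable [measurable]: "bump \<in> borel_measurable borel" "bump_grad \<in> borel_measurable borel"
  unfolding bump_def bump_grad_def by measurable

lemma bump_bounds: "0 \<le> bump z" "bump z \<le> 1" "norm (bump_grad z) \<le> 4"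
proof -
  define a where "a = max 0 (1 - (norm z)\<^sup>2)"
  have a: "0 \<le> a" "a \<le> 1" by (auto simp: a_def)
  show "0 \<le> bump z" "bump z \<le> 1" using a by (auto simp: bump_def a_def[symmetric] power_le_one)
  show "norm (bump_grad z) \<le> 4"
  proof (cases "norm z \<le> 1")
    case True
    then have "a * norm z \<le> 1 * 1" using a by (intro mult_mono) auto
    then show ?thesis using a by (simp add: bump_grad_def a_def[symmetric])
  next
    case False
    then have "a = 0" by (simp add: a_def)
    then show ?thesis by (simp add: bump_grad_def a_def[symmetric])
  qed
qed

lemma bump_outside: "norm z > 1 \<Longrightarrow> bump z = 0" "norm z > 1 \<Longrightarrow> bump_grad z = 0"
proof -
  have "max 0 (1 - (norm z)\<^sup>2) = 0" if "norm z > 1"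
    using one_less_power[OF that, of 2] by simp
  then show "norm z > 1 \<Longrightarrow> bump z = 0" "norm z > 1 \<Longrightarrow> bump_grad z = 0"
    by (simp_all add: bump_def bump_grad_def)
qed

text \<open>The function \<open>(max 0 (1 - r))\<^sup>2\<close> differs from its tangent at \<open>r\<close> by at most the squared increment; here
  \<open>r = (norm z)\<^sup>2\<close>, which changes by \<open>d = (norm h)\<^sup>2 - 2 * (z \<bullet> h)\<close>.  The quadratic part of \<open>d\<close> is not in the
  gradient term and gives the second summand.\<close>

lemma bump_taylor:
  "\<bar>bump (z - h) - bump z + bump_grad z \<bullet> h\<bar> \<le> (2 * (z \<bullet> h) - (norm h)\<^sup>2)\<^sup>2 + 2 * (norm h)\<^sup>2"
proof -
  define a b d where "a = max 0 (1 - (norm z)\<^sup>2)" and "b = max 0 (1 - (norm (z - h))\<^sup>2)"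
    and "d = (norm h)\<^sup>2 - 2 * (z \<bullet> h)"
  have "(norm (z - h))\<^sup>2 = (norm z)\<^sup>2 + d"
    unfolding d_def power2_norm_eq_inner by (simp add: inner_diff_left inner_diff_right inner_commute algebra_simps)
  then have b: "b = max 0 (1 - (norm z)\<^sup>2 - d)" by (simp add: b_def)
  have a: "0 \<le> a" "a \<le> 1" by (auto simp: a_def)
  have "\<bar>b\<^sup>2 - a\<^sup>2 + 2 * a * d\<bar> \<le> d\<^sup>2"
  proof -
    define t where "t = 1 - (norm z)\<^sup>2"
    have ab: "a = max 0 t" "b = max 0 (t - d)" by (simp_all add: a_def b t_def)
    consider "t \<ge> 0" "t - d \<ge> 0" | "t \<ge> 0" "t - d < 0" | "t < 0" "t - d \<ge> 0" | "t < 0" "t - d < 0"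
      by linarith
    then show ?thesis
    proof cases
      case 1
      then have "b\<^sup>2 - a\<^sup>2 + 2 * a * d = d\<^sup>2"
        by (simp add: ab power2_eq_square algebra_simps)
      then show ?thesis by simp
    next
      case 2
      then have "b\<^sup>2 - a\<^sup>2 + 2 * a * d = d\<^sup>2 - (d - t)\<^sup>2"
        by (simp add: ab power2_eq_square algebra_simps)
      moreover have "0 \<le> t * (2 * d - t)" using 2 by (intro mult_nonneg_nonneg) auto
      moreover have "d\<^sup>2 - (d - t)\<^sup>2 = t * (2 * d - t)"
        by (simp add: power2_eq_square algebra_simps)
      ultimately show ?thesis
        using zero_le_power2[of "d - t"] zero_le_power2[of d] by linarith
    next
      case 3
      then have "b\<^sup>2 - a\<^sup>2 + 2 * a * d = (t - d)\<^sup>2" by (simp add: ab)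
      moreover have "(t - d)\<^sup>2 \<le> (- d)\<^sup>2" using 3 by (intro power_mono) auto
      ultimately show ?thesis by simp
    next
      case 4
      then show ?thesis by (simp add: ab)
    qed
  qed
  moreover have "bump (z - h) - bump z + bump_grad z \<bullet> h = (b\<^sup>2 - a\<^sup>2 + 2 * a * d) - 2 * a * (norm h)\<^sup>2"
    by (simp add: bump_def bump_grad_def a_def[symmetric] b_def[symmetric] d_def algebra_simps)
  moreover have "2 * a * (norm h)\<^sup>2 \<le> 2 * (norm h)\<^sup>2" "0 \<le> 2 * a * (norm h)\<^sup>2"
    using mult_right_mono[OF a(2), of "(norm h)\<^sup>2"] a by simp_all
  moreover have "d\<^sup>2 = (2 * (z \<bullet> h) - (norm h)\<^sup>2)\<^sup>2" by (simp add: d_def power2_commute)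
  ultimately show ?thesis by linarith
qed

lemma bump_taylor_local:
  assumes "norm h \<le> 1"
  shows "\<bar>bump (z - h) - bump z + bump_grad z \<bullet> h\<bar> \<le> 27 * (norm h)\<^sup>2 * indicator (cball 0 2) z"
proof (cases "norm z \<le> 2")
  case True
  have "\<bar>2 * (z \<bullet> h) - (norm h)\<^sup>2\<bar> \<le> 5 * norm h"
  proof -
    have "\<bar>z \<bullet> h\<bar> \<le> 2 * norm h"
      using Cauchy_Schwarz_ineq2[of z h] mult_right_mono[OF True, of "norm h"] by simp
    moreover have "(norm h)\<^sup>2 \<le> norm h" using assms by (simp add: power2_eq_square mult_left_le)
    ultimately show ?thesis using zero_le_power2[of "norm h"] by linarith
  qed
  then have "(2 * (z \<bullet> h) - (norm h)\<^sup>2)\<^sup>2 \<le> (5 * norm h)\<^sup>2"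
    by (metis abs_ge_zero power2_abs power_mono)
  then show ?thesis using bump_taylor[of z h] True by (simp add: power_mult_distrib)
next
  case False
  have "norm z \<le> norm (z - h) + norm h" using norm_triangle_ineq[of "z - h" h] by simp
  then have "norm (z - h) > 1" "norm z > 1" using False assms by linarith+
  then show ?thesis using False by (simp add: bump_outside)
qed

lemma smoothly_increasing_rescale:
  assumes "smoothly_increasing F" "c > 0" "d > 0"
  shows "smoothly_increasing (\<lambda>x. d * F (c *\<^sub>R x))"
proof -
  obtain C where C: "\<And>x. \<bar>F x\<bar> \<le> C"
    "\<And>x. \<exists>v. (\<forall>i. 0 \<le> v $ i) \<and> norm v \<le> C \<and> (\<forall>h. \<bar>F (x + h) - F x - v \<bullet> h\<bar> \<le> C * (norm h)\<^sup>2)"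
    using assms(1) unfolding smoothly_increasing_def by metis
  have C0: "C \<ge> 0" using C(1)[of 0] by linarith
  define C' where "C' = d * C + d * c * C + d * c\<^sup>2 * C"
  have C': "d * C \<le> C'" "d * c * C \<le> C'" "d * c\<^sup>2 * C \<le> C'"
    using assms C0 by (auto simp: C'_def)
  show ?thesis
    unfolding smoothly_increasing_def
  proof (intro exI[of _ C'] allI conjI)
    fix x
    show "\<bar>d * F (c *\<^sub>R x)\<bar> \<le> C'"
    proof -
      have "d * \<bar>F (c *\<^sub>R x)\<bar> \<le> d * C" using C(1) assms by (intro mult_left_mono) auto
      moreover have "\<bar>d * F (c *\<^sub>R x)\<bar> = d * \<bar>F (c *\<^sub>R x)\<bar>" using assms by (simp add: abs_mult)
      ultimately show ?thesis using C'(1) by linarith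
    qed
    obtain v where v: "\<And>i. 0 \<le> v $ i" "norm v \<le> C"
      "\<And>h. \<bar>F (c *\<^sub>R x + h) - F (c *\<^sub>R x) - v \<bullet> h\<bar> \<le> C * (norm h)\<^sup>2"
      using C(2) by blast
    have "\<bar>d * F (c *\<^sub>R (x + h)) - d * F (c *\<^sub>R x) - ((d * c) *\<^sub>R v) \<bullet> h\<bar> \<le> C' * (norm h)\<^sup>2" for h
    proof -
      have "d * F (c *\<^sub>R (x + h)) - d * F (c *\<^sub>R x) - ((d * c) *\<^sub>R v) \<bullet> h =
          d * (F (c *\<^sub>R x + c *\<^sub>R h) - F (c *\<^sub>R x) - v \<bullet> (c *\<^sub>R h))"
        by (simp add: algebra_simps)
      also have "\<bar>\<dots>\<bar> \<le> d * (C * (norm (c *\<^sub>R h))\<^sup>2)"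
        using assms v(3)[of "c *\<^sub>R h"] by (simp add: abs_mult)
      also have "\<dots> = (d * c\<^sup>2 * C) * (norm h)\<^sup>2" by (simp add: power_mult_distrib)
      also have "\<dots> \<le> C' * (norm h)\<^sup>2" using C' by (intro mult_right_mono) auto
      finally show ?thesis .
    qed
    moreover have "norm ((d * c) *\<^sub>R v) \<le> C'"
    proof -
      have "d * c * norm v \<le> d * c * C" using v(2) assms by (intro mult_left_mono) auto
      moreover have "norm ((d * c) *\<^sub>R v) = d * c * norm v" using assms by (simp add: abs_mult)
      ultimately show ?thesis using C'(2) by linarith
    qed
    ultimately show "\<exists>v. (\<forall>i. 0 \<le> v $ i) \<and> norm v \<le> C' \<and>
        (\<forall>h. \<bar>d * F (c *\<^sub>R (x + h)) - d * F (c *\<^sub>R x) - v \<bullet> h\<bar> \<le> C' * (norm h)\<^sup>2)"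
      using v(1) assms by (intro exI[of _ "(d * c) *\<^sub>R v"]) auto
  qed
qed

lemma integrable_bump_weighted:
  fixes f :: "real ^ 'd \<Rightarrow> real"
  assumes [measurable]: "f \<in> borel_measurable borel" and N: "\<And>x. \<bar>f x\<bar> \<le> N"
  shows "integrable lborel (\<lambda>z. f (x + z) * bump (z - h))"
    and "integrable lborel (\<lambda>z. f (x + z) *\<^sub>R bump_grad z)"
proof -
  have N0: "N \<ge> 0" using N[of 0] by linarith
  have ball: "integrable lborel (\<lambda>z :: real ^ 'd. B * indicator (cball y 1) z :: real)" for B y
    by (intro integrable_mult_right integrable_real_indicator emeasure_lborel_cball_finite) auto
  show "integrable lborel (\<lambda>z. f (x + z) * bump (z - h))"
  proof (rule Bochner_Integration.integrable_bound[OF ball[of N h]])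
    have "\<bar>f (x + z) * bump (z - h)\<bar> \<le> N * indicator (cball h 1) z" for z
    proof (cases "z \<in> cball h 1")
      case True
      have "\<bar>f (x + z) * bump (z - h)\<bar> \<le> N * 1"
        unfolding abs_mult using N N0 bump_bounds[of "z - h"] by (intro mult_mono) auto
      then show ?thesis using True by simp
    next
      case False
      then have "bump (z - h) = 0" by (intro bump_outside) (simp add: dist_norm norm_minus_commute)
      then show ?thesis using False by simp
    qed
    then show "AE z in lborel. norm (f (x + z) * bump (z - h)) \<le> norm (N * indicator (cball h 1) z :: real)"
      by (intro AE_I2) (metis abs_ge_self order_trans real_norm_def)
  qed measurable
  show "integrable lborel (\<lambda>z. f (x + z) *\<^sub>R bump_grad z)"
  proof (rule Bochner_Integration.integrable_bound[OF ball[of "N * 4" 0]])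
    have "norm (f (x + z) *\<^sub>R bump_grad z) \<le> N * 4 * indicator (cball 0 1) z" for z
    proof (cases "z \<in> cball 0 1")
      case True
      have "norm (f (x + z) *\<^sub>R bump_grad z) \<le> N * 4"
        unfolding norm_scaleR using N N0 bump_bounds[of z] by (intro mult_mono) auto
      then show ?thesis using True by simp
    next
      case False
      then have "bump_grad z = 0" by (intro bump_outside) simp
      then show ?thesis using False by simp
    qed
    then show "AE z in lborel. norm (f (x + z) *\<^sub>R bump_grad z) \<le> norm (N * 4 * indicator (cball 0 1) z :: real)"
      by (intro AE_I2) (metis abs_ge_self order_trans real_norm_def)
  qed measurable
qed

lemma lborel_integral_shift:
  fixes \<phi> :: "real ^ 'd \<Rightarrow> real"
  assumes [measurable]: "\<phi> \<in> borel_measurable borel"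
  shows "(LINT z|lborel. \<phi> z) = (LINT z|lborel. \<phi> (z - h))"
proof -
  have "(LINT z|lborel. \<phi> z) = (LINT z|distr lborel borel ((+) (- h)). \<phi> z)"
    by (simp add: lborel_distr_plus)
  also have "\<dots> = (LINT z|lborel. \<phi> (z - h))"
    by (subst integral_distr) auto
  finally show ?thesis .
qed

text \<open>Shifting the argument of the convolution shifts the kernel, so all derivatives fall on \<open>bump\<close> and
  the Taylor estimate of the kernel is integrated against the bounded function \<open>f\<close>.  The gradient is nonnegative because the convolution inherits
  monotonicity from \<open>f\<close>.\<close>

lemma bump_smoothing_smoothly_increasing:
  fixes f :: "real ^ 'd \<Rightarrow> real"
  assumes f: "mono f" and meas[measurable]: "f \<in> borel_measurable borel" and N: "\<And>x. \<bar>f x\<bar> \<le> N"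
  shows "smoothly_increasing (\<lambda>x. LINT z|lborel. f (x + z) * bump z)"
proof -
  define F where "F x = (LINT z|lborel. f (x + z) * bump z)" for x
  define V where "V x = - (LINT z|lborel. f (x + z) *\<^sub>R bump_grad z)" for x
  have N0: "N \<ge> 0" using N[of 0] by linarith
  note wi = integrable_bump_weighted[OF meas N]
  note wi0 = wi(1)[where h=0, simplified]
  have ball: "integrable lborel (\<lambda>z :: real ^ 'd. B * indicator (cball 0 r) z :: real)" for B r
    by (intro integrable_mult_right integrable_real_indicator emeasure_lborel_cball_finite) auto
  define c1 c2 where "c1 = measure lborel (cball 0 1 :: (real ^ 'd) set)"
    and "c2 = measure lborel (cball 0 2 :: (real ^ 'd) set)"
  have c0: "0 \<le> c1" "0 \<le> c2" by (simp_all add: c1_def c2_def)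
  have Fb: "\<bar>F x\<bar> \<le> N * c1" for x
  proof -
    have "\<bar>F x\<bar> \<le> (LINT z|lborel. \<bar>f (x + z) * bump z\<bar>)"
      unfolding F_def by (rule integral_abs_bound)
    also have "\<dots> \<le> (LINT z|lborel. N * indicator (cball 0 1) (z :: real ^ 'd))"
    proof (intro integral_mono integrable_abs wi0 ball)
      fix z :: "real ^ 'd"
      have "\<bar>f (x + z) * bump z\<bar> \<le> N * 1"
        unfolding abs_mult using N N0 bump_bounds[of z] by (intro mult_mono) auto
      then show "\<bar>f (x + z) * bump z\<bar> \<le> N * indicator (cball 0 1) z"
        using bump_outside(1)[of z] by (cases "norm z \<le> 1") auto
    qed
    finally show ?thesis by (simp add: c1_def)
  qed
  have Vb: "norm (V x) \<le> N * 4 * c1" for x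
  proof -
    have "norm (V x) \<le> (LINT z|lborel. norm (f (x + z) *\<^sub>R bump_grad z))"
      unfolding V_def norm_minus_cancel by (rule integral_norm_bound)
    also have "\<dots> \<le> (LINT z|lborel. N * 4 * indicator (cball 0 1) (z :: real ^ 'd))"
    proof (intro integral_mono integrable_norm wi ball)
      fix z :: "real ^ 'd"
      have "norm (f (x + z) *\<^sub>R bump_grad z) \<le> N * 4"
        unfolding norm_scaleR using N N0 bump_bounds[of z] by (intro mult_mono) auto
      then show "norm (f (x + z) *\<^sub>R bump_grad z) \<le> N * 4 * indicator (cball 0 1) z"
        using bump_outside(2)[of z] by (cases "norm z \<le> 1") auto
    qed
    finally show ?thesis by (simp add: c1_def)
  qed
  define C where "C = 2 * (N * c1) + N * 4 * c1 + 27 * N * c2"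
  have C: "N * c1 \<le> C" "N * 4 * c1 \<le> C" "2 * (N * c1) + N * 4 * c1 \<le> C" "27 * N * c2 \<le> C" "0 \<le> C"
    using N0 c0 by (auto simp: C_def)
  have taylor: "\<bar>F (x + h) - F x - V x \<bullet> h\<bar> \<le> C * (norm h)\<^sup>2" for x h
  proof (cases "norm h \<le> 1")
    case True
    have Fh: "F (x + h) = (LINT z|lborel. f (x + z) * bump (z - h))"
      unfolding F_def by (subst lborel_integral_shift[where h=h]) auto
    note i1 = wi(1)[of x h] and i2 = wi0[of x] and i3 = integrable_inner_left[OF wi(2)[of x], of h]
    have "F (x + h) - F x - V x \<bullet> h =
        (LINT z|lborel. f (x + z) * bump (z - h)) - (LINT z|lborel. f (x + z) * bump z)
         + (LINT z|lborel. (f (x + z) *\<^sub>R bump_grad z) \<bullet> h)"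
      unfolding Fh unfolding F_def V_def
      by (simp only: integral_inner_left[OF wi(2)] inner_minus_left diff_minus_eq_add)
    also have "\<dots> = (LINT z|lborel. f (x + z) * bump (z - h) - f (x + z) * bump z + (f (x + z) *\<^sub>R bump_grad z) \<bullet> h)"
      by (simp only: Bochner_Integration.integral_add[OF Bochner_Integration.integrable_diff[OF i1 i2] i3]
          Bochner_Integration.integral_diff[OF i1 i2])
    finally have eq: "F (x + h) - F x - V x \<bullet> h =
        (LINT z|lborel. f (x + z) * bump (z - h) - f (x + z) * bump z + (f (x + z) *\<^sub>R bump_grad z) \<bullet> h)" .
    have "\<bar>F (x + h) - F x - V x \<bullet> h\<bar> \<le> (LINT z|lborel. \<bar>f (x + z) * bump (z - h) - f (x + z) * bump z + (f (x + z) *\<^sub>R bump_grad z) \<bullet> h\<bar>)"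
      unfolding eq by (rule integral_abs_bound)
    also have "\<dots> \<le> (LINT z|lborel. (27 * N * (norm h)\<^sup>2) * indicator (cball 0 2) (z :: real ^ 'd))"
    proof (rule integral_mono)
      show "integrable lborel (\<lambda>z. \<bar>f (x + z) * bump (z - h) - f (x + z) * bump z + (f (x + z) *\<^sub>R bump_grad z) \<bullet> h\<bar>)"
        by (rule integrable_abs[OF Bochner_Integration.integrable_add[OF Bochner_Integration.integrable_diff[OF i1 i2] i3]])
      show "integrable lborel (\<lambda>z :: real ^ 'd. (27 * N * (norm h)\<^sup>2) * indicator (cball 0 2) z :: real)"
        by (rule ball)
      fix z :: "real ^ 'd"
      have factor: "f (x + z) * bump (z - h) - f (x + z) * bump z + (f (x + z) *\<^sub>R bump_grad z) \<bullet> h =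
          f (x + z) * (bump (z - h) - bump z + bump_grad z \<bullet> h)"
        by (simp add: distrib_left right_diff_distrib)
      have "\<bar>f (x + z) * (bump (z - h) - bump z + bump_grad z \<bullet> h)\<bar>
          \<le> N * (27 * (norm h)\<^sup>2 * indicator (cball 0 2) z)"
        unfolding abs_mult using N N0 bump_taylor_local[OF True] by (intro mult_mono) auto
      then show "\<bar>f (x + z) * bump (z - h) - f (x + z) * bump z + (f (x + z) *\<^sub>R bump_grad z) \<bullet> h\<bar>
          \<le> (27 * N * (norm h)\<^sup>2) * indicator (cball 0 2) z"
        unfolding factor by (simp only: ac_simps)
    qed
    also have "\<dots> = (27 * N * c2) * (norm h)\<^sup>2" by (simp add: c2_def)
    also have "\<dots> \<le> C * (norm h)\<^sup>2" using C by (intro mult_right_mono) auto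
    finally show ?thesis .
  next
    \<comment> \<open>For large increments the bounds on \<open>F\<close> and \<open>V\<close> alone suffice.\<close>
    case False
    have "\<bar>V x \<bullet> h\<bar> \<le> (N * 4 * c1) * norm h"
      using Cauchy_Schwarz_ineq2[of "V x" h] mult_right_mono[OF Vb[of x], of "norm h"] by simp
    then have "\<bar>F (x + h) - F x - V x \<bullet> h\<bar> \<le> 2 * (N * c1) + (N * 4 * c1) * norm h"
      using Fb[of x] Fb[of "x + h"] by linarith
    also have "\<dots> \<le> 2 * (N * c1) * (norm h)\<^sup>2 + (N * 4 * c1) * (norm h)\<^sup>2"
    proof (intro add_mono)
      have "1 \<le> (norm h)\<^sup>2" "norm h \<le> (norm h)\<^sup>2"
        using False one_le_power[of "norm h" 2] self_le_power[of "norm h" 2] by simp_all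
      then show "2 * (N * c1) \<le> 2 * (N * c1) * (norm h)\<^sup>2" "N * 4 * c1 * norm h \<le> N * 4 * c1 * (norm h)\<^sup>2"
        using N0 c0 mult_left_mono[of 1 "(norm h)\<^sup>2" "2 * (N * c1)"] by (auto intro: mult_left_mono)
    qed
    also have "\<dots> = (2 * (N * c1) + N * 4 * c1) * (norm h)\<^sup>2" by (simp add: algebra_simps)
    also have "\<dots> \<le> C * (norm h)\<^sup>2" using C by (intro mult_right_mono) auto
    finally show ?thesis .
  qed
  have Fmono: "F x \<le> F y" if "x \<le> y" for x y
  proof -
    have "f (x + z) \<le> f (y + z)" for z using that by (intro monoD[OF f]) (simp add: less_eq_vec_def)
    then show ?thesis
      unfolding F_def using wi0 bump_bounds by (intro integral_mono) (auto intro: mult_right_mono)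
  qed
  have V0: "0 \<le> V x $ i" for x i
  proof -
    have *: "- (C * t) \<le> V x $ i" if t: "t > 0" for t
    proof -
      have "x \<le> x + axis i t" using t by (auto simp: less_eq_vec_def axis_def)
      then have "0 \<le> F (x + axis i t) - F x" using Fmono by simp
      moreover have "\<bar>F (x + axis i t) - F x - t * V x $ i\<bar> \<le> C * t\<^sup>2"
      proof -
        have "axis i t = t *\<^sub>R (axis i 1 :: real ^ 'd)" by (simp add: vec_eq_iff axis_def)
        then have "norm (axis i t :: real ^ 'd) = t" using t by (simp add: norm_axis_1)
        then show ?thesis using taylor[of x "axis i t"] by (simp add: inner_axis mult.commute)
      qed
      ultimately have "0 \<le> t * (V x $ i + C * t)" by (simp add: power2_eq_square algebra_simps)
      then show ?thesis using t by (simp add: zero_le_mult_iff)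
    qed
    show ?thesis
    proof (rule tendsto_le[OF _ tendsto_const])
      show "((\<lambda>t. - (C * t)) \<longlongrightarrow> 0) (at_right 0)" by (auto intro!: tendsto_eq_intros)
      show "\<forall>\<^sub>F t in at_right 0. - (C * t) \<le> V x $ i"
        using * by (auto simp: eventually_at_right_less intro: eventually_mono[OF eventually_at_right_less])
    qed simp
  qed
  have "smoothly_increasing F"
    unfolding smoothly_increasing_def
    using order_trans[OF Fb C(1)] order_trans[OF Vb C(2)] taylor V0 by blast
  then show ?thesis by (simp add: F_def[abs_def])
qed

lemma integral_bump_pos: "0 < (LINT z|lborel. bump (z :: real ^ 'd))"
proof -
  have "0 < (9 / 16) * measure lborel (cball (0 :: real ^ 'd) (1/2))"
    by (simp add: content_cball_pos)
  also have "\<dots> = (LINT z|lborel. (9 / 16) * indicator (cball (0 :: real ^ 'd) (1/2)) z)"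
    by simp
  also have "\<dots> \<le> (LINT z|lborel. bump (z :: real ^ 'd))"
  proof (intro integral_mono)
    show "integrable lborel (\<lambda>z. 9 / 16 * indicator (cball (0 :: real ^ 'd) (1/2)) z :: real)"
      by (intro integrable_mult_right integrable_real_indicator emeasure_lborel_cball_finite) auto
    show "integrable lborel (bump :: real ^ 'd \<Rightarrow> real)"
      using integrable_bump_weighted(1)[of "\<lambda>_ :: real ^ 'd. 1" 1 0 0] by simp
    fix z :: "real ^ 'd"
    show "9 / 16 * indicator (cball 0 (1/2)) z \<le> bump z"
    proof (cases "norm z \<le> 1/2")
      case True
      then have "(norm z)\<^sup>2 \<le> (1/2)\<^sup>2" by (intro power_mono) auto
      then have "3/4 \<le> max 0 (1 - (norm z)\<^sup>2)" by (simp add: power2_eq_square)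
      then have "(3/4)\<^sup>2 \<le> bump z" unfolding bump_def by (rule power_mono) simp
      then show ?thesis using True by (simp add: power2_eq_square)
    next
      case False
      then show ?thesis using bump_bounds(1)[of z] by simp
    qed
  qed
  finally show ?thesis .
qed

text \<open>The support of the kernel lies in the unit ball, so after rescaling \<open>f\<close> is evaluated only within the
  box of radius \<open>\<delta>\<close> around \<open>x\<close>; by monotonicity the two opposite corners of the box control the
  average.\<close>

lemma smoothly_increasing_approximation:
  fixes f :: "real ^ 'd \<Rightarrow> real"
  assumes f: "mono f" and meas[measurable]: "f \<in> borel_measurable borel" and N: "\<And>x. \<bar>f x\<bar> \<le> N"
    and \<delta>: "\<delta> > 0"
  shows "\<exists>F. smoothly_increasing F \<and> mono F \<and> (\<forall>x. f (x - \<delta> *\<^sub>R 1) \<le> F x \<and> F x \<le> f (x + \<delta> *\<^sub>R 1))"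
proof -
  define \<phi> where "\<phi> x = f (\<delta> *\<^sub>R x)" for x
  have [measurable]: "\<phi> \<in> borel_measurable borel" unfolding \<phi>_def by measurable
  have \<phi>N: "\<bar>\<phi> x\<bar> \<le> N" for x using N by (simp add: \<phi>_def)
  have "mono \<phi>" using f \<delta> by (auto simp: \<phi>_def mono_def less_eq_vec_def)
  then have smooth: "smoothly_increasing (\<lambda>x. LINT z|lborel. \<phi> (x + z) * bump z)"
    by (rule bump_smoothing_smoothly_increasing[OF _ _ \<phi>N]) measurable
  define I where "I = (LINT z|lborel. bump (z :: real ^ 'd))"
  have I: "I > 0" unfolding I_def by (rule integral_bump_pos)
  define F where "F x = (1 / I) * (LINT z|lborel. \<phi> ((1 / \<delta>) *\<^sub>R x + z) * bump z)" for x
  have F: "F x = (1 / I) * (LINT z|lborel. f (x + \<delta> *\<^sub>R z) * bump z)" for x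
    using \<delta> by (simp add: F_def \<phi>_def scaleR_add_right)
  have int: "integrable lborel (\<lambda>z. f (x + \<delta> *\<^sub>R z) * bump z)" for x
    using integrable_bump_weighted(1)[of \<phi> N "(1 / \<delta>) *\<^sub>R x" 0] \<phi>N \<delta> by (simp add: \<phi>_def scaleR_add_right)
  have intc: "integrable lborel (\<lambda>z :: real ^ 'd. c * bump z)" for c
    using integrable_bump_weighted(1)[of "\<lambda>_ :: real ^ 'd. 1" 1 0 0] by simp
  have "smoothly_increasing F"
    unfolding F_def using I \<delta> by (intro smoothly_increasing_rescale[OF smooth]) auto
  moreover have "mono F"
  proof (rule monoI)
    fix x y :: "real ^ 'd" assume "x \<le> y"
    then have "f (x + z) \<le> f (y + z)" for z by (intro monoD[OF f]) (simp add: less_eq_vec_def)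
    then show "F x \<le> F y"
      unfolding F using I int bump_bounds
      by (intro mult_left_mono integral_mono) (auto intro: mult_right_mono)
  qed
  moreover have "f (x - \<delta> *\<^sub>R 1) \<le> F x \<and> F x \<le> f (x + \<delta> *\<^sub>R 1)" for x
  proof -
    have sandwich: "f (x - \<delta> *\<^sub>R 1) * bump z \<le> f (x + \<delta> *\<^sub>R z) * bump z \<and>
      f (x + \<delta> *\<^sub>R z) * bump z \<le> f (x + \<delta> *\<^sub>R 1) * bump z" for z
    proof (cases "norm z \<le> 1")
      case True
      then have "\<bar>z $ i\<bar> \<le> 1" for i using component_le_norm_cart[of z i] by linarith
      then have "- 1 \<le> z $ i" "z $ i \<le> 1" for i by (auto simp: abs_le_iff minus_le_iff)
      then have "x - \<delta> *\<^sub>R 1 \<le> x + \<delta> *\<^sub>R z" "x + \<delta> *\<^sub>R z \<le> x + \<delta> *\<^sub>R 1"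
        using \<delta> mult_left_mono[of "-1" "z $ i" \<delta> for i] by (auto simp: less_eq_vec_def)
      then show ?thesis using bump_bounds(1) by (blast intro: mult_right_mono monoD[OF f])
    next
      case False
      then show ?thesis by (simp add: bump_outside)
    qed
    have "f (x - \<delta> *\<^sub>R 1) * I \<le> (LINT z|lborel. f (x + \<delta> *\<^sub>R z) * bump z)"
      unfolding I_def integral_mult_right_zero[symmetric]
      using sandwich by (intro integral_mono intc int) auto
    moreover have "(LINT z|lborel. f (x + \<delta> *\<^sub>R z) * bump z) \<le> f (x + \<delta> *\<^sub>R 1) * I"
      unfolding I_def integral_mult_right_zero[symmetric]
      using sandwich by (intro integral_mono intc int) auto
    ultimately show ?thesis unfolding F using I by (simp add: field_simps)
  qed
  ultimately show ?thesis by blast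
qed

section \<open>Mixtures along the diagonal and association\<close>

text \<open>Chebyshev's inequality: \<open>(F x - F y) * (G x - G y)\<close> is nonnegative, and its double integral is twice the
  covariance.\<close>

lemma chebyshev_covariance:
  fixes M :: "real measure" and F G :: "real \<Rightarrow> real"
  assumes "prob_space M" and [measurable_cong]: "sets M = sets borel"
    and F: "mono F" and G: "mono G" and bound: "\<And>x. \<bar>F x\<bar> \<le> C" "\<And>x. \<bar>G x\<bar> \<le> C"
  shows "(LINT x|M. F x) * (LINT x|M. G x) \<le> (LINT x|M. F x * G x)"
proof -
  interpret prob_space M by fact
  note [measurable] = borel_measurable_mono[OF F] borel_measurable_mono[OF G]
  have C0: "C \<ge> 0" using bound(1)[of 0] by linarith
  have prod: "\<bar>F x * G x\<bar> \<le> C * C" for x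
    using bound C0 by (auto simp: abs_mult intro!: mult_mono)
  have iF: "integrable M F" by (rule integrable_const_bound[where B=C]) (auto simp: bound)
  have iG: "integrable M G" by (rule integrable_const_bound[where B=C]) (auto simp: bound)
  have iFG: "integrable M (\<lambda>x. F x * G x)"
    by (rule integrable_const_bound[where B="C * C"]) (auto simp: prod)
  have "0 \<le> (LINT x|M. LINT y|M. (F x - F y) * (G x - G y))"
  proof (intro integral_nonneg_AE AE_I2)
    fix x y
    show "0 \<le> (F x - F y) * (G x - G y)"
      using monoD[OF F, of x y] monoD[OF F, of y x] monoD[OF G, of x y] monoD[OF G, of y x]
      by (cases "x \<le> y") (auto intro: mult_nonneg_nonneg mult_nonpos_nonpos)
  qed
  also have "\<dots> = (LINT x|M. LINT y|M. F x * G x - F x * G y - G x * F y + F y * G y)"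
    by (simp add: algebra_simps)
  also have "\<dots> = (LINT x|M. F x * G x - F x * (LINT y|M. G y) - G x * (LINT y|M. F y) + (LINT y|M. F y * G y))"
    using iF iG iFG by (simp add: prob_space)
  also have "\<dots> = 2 * (LINT x|M. F x * G x) - 2 * ((LINT x|M. F x) * (LINT x|M. G x))"
    using iF iG iFG by (simp add: prob_space)
  finally show ?thesis by simp
qed

text \<open>Along the diagonal direction \<open>f\<close> is a monotone function of one variable, which has only countably many
  discontinuities.\<close>

lemma AE_tendsto_along_diagonal:
  fixes f :: "real ^ 'd \<Rightarrow> real" and \<epsilon> :: "nat \<Rightarrow> real"
  assumes f: "mono f" and \<epsilon>: "\<epsilon> \<longlonglongrightarrow> 0"
    and sandwich: "\<And>n x. f (x - \<epsilon> n *\<^sub>R 1) \<le> F n x" "\<And>n x. F n x \<le> f (x + \<epsilon> n *\<^sub>R 1)"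
  shows "AE e in lborel. (\<lambda>n. F n (e *\<^sub>R 1 + w)) \<longlonglongrightarrow> f (e *\<^sub>R 1 + w)"
proof -
  define \<phi> where "\<phi> e = f (e *\<^sub>R 1 + w)" for e
  have "mono \<phi>" unfolding \<phi>_def by (intro monoI monoD[OF f]) (simp add: less_eq_vec_def)
  then have "{e. \<not> isCont \<phi> e} \<in> null_sets lborel"
    by (intro countable_imp_null_set_lborel mono_ctble_discont)
  then have "AE e in lborel. isCont \<phi> e"
    by (rule AE_mp[OF AE_not_in]) simp
  then show ?thesis
  proof eventually_elim
    case (elim e)
    have lim: "(\<lambda>n. e - \<epsilon> n) \<longlonglongrightarrow> e" "(\<lambda>n. e + \<epsilon> n) \<longlonglongrightarrow> e"
      using tendsto_diff[OF tendsto_const \<epsilon>, of e] tendsto_add[OF tendsto_const \<epsilon>, of e] by simp_all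
    have lower: "(\<lambda>n. \<phi> (e - \<epsilon> n)) \<longlonglongrightarrow> \<phi> e" and upper: "(\<lambda>n. \<phi> (e + \<epsilon> n)) \<longlonglongrightarrow> \<phi> e"
      using isCont_tendsto_compose[OF elim] lim by blast+
    have "(\<lambda>n. F n (e *\<^sub>R 1 + w)) \<longlonglongrightarrow> \<phi> e"
    proof (rule tendsto_sandwich[OF _ _ lower upper])
      show "\<forall>\<^sub>F n in sequentially. \<phi> (e - \<epsilon> n) \<le> F n (e *\<^sub>R 1 + w)"
        using sandwich(1)[of "e *\<^sub>R 1 + w"] by (simp add: \<phi>_def algebra_simps)
      show "\<forall>\<^sub>F n in sequentially. F n (e *\<^sub>R 1 + w) \<le> \<phi> (e + \<epsilon> n)"
        using sandwich(2)[of _ "e *\<^sub>R 1 + w"] by (simp add: \<phi>_def algebra_simps)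
    qed
    then show ?case by (simp add: \<phi>_def)
  qed
qed

text \<open>Dominated convergence is applied first in \<open>e\<close> for fixed \<open>w\<close>, then in \<open>w\<close>, so that the almost sure
  convergence is required on each diagonal line only.\<close>

lemma tendsto_integral_diagonal_mixture:
  fixes h :: "real ^ 'd \<Rightarrow> real"
  assumes S: "prob_space S" "sets S = sets borel" and L: "prob_space L" "sets L = sets borel"
    and [measurable]: "\<And>n. H n \<in> borel_measurable borel" "h \<in> borel_measurable borel"
    and bound: "\<And>n x. \<bar>H n x\<bar> \<le> B" "\<And>x. \<bar>h x\<bar> \<le> B"
    and lim: "\<And>w. AE e in S. (\<lambda>n. H n (e *\<^sub>R 1 + w)) \<longlonglongrightarrow> h (e *\<^sub>R 1 + w)"
  shows "(\<lambda>n. LINT x|distr (S \<Otimes>\<^sub>M L) borel (\<lambda>(e, w). e *\<^sub>R 1 + w). H n x)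
    \<longlonglongrightarrow> (LINT x|distr (S \<Otimes>\<^sub>M L) borel (\<lambda>(e, w). e *\<^sub>R 1 + w). h x)"
proof -
  interpret S: prob_space S by fact
  interpret L: prob_space L by fact
  interpret P: pair_prob_space S L ..
  note [measurable_cong] = S(2) L(2)
  have iterated: "(LINT x|distr (S \<Otimes>\<^sub>M L) borel (\<lambda>(e, w). e *\<^sub>R 1 + w). q x) =
      (LINT w|L. LINT e|S. q (e *\<^sub>R 1 + w))"
    if [measurable]: "q \<in> borel_measurable borel" and q: "\<And>x. \<bar>q x\<bar> \<le> B" for q :: "real ^ 'd \<Rightarrow> real"
  proof -
    have "(LINT x|distr (S \<Otimes>\<^sub>M L) borel (\<lambda>(e, w). e *\<^sub>R 1 + w). q x) =
        (LINT z|(S \<Otimes>\<^sub>M L). (case z of (e, w) \<Rightarrow> q (e *\<^sub>R 1 + w)))"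
      by (subst integral_distr) (auto intro!: Bochner_Integration.integral_cong)
    also have "\<dots> = (LINT w|L. LINT e|S. q (e *\<^sub>R 1 + w))"
      using q by (intro P.integral_snd[symmetric] P.integrable_const_bound[where B=B]) auto
    finally show ?thesis .
  qed
  have inner: "(\<lambda>n. LINT e|S. H n (e *\<^sub>R 1 + w)) \<longlonglongrightarrow> (LINT e|S. h (e *\<^sub>R 1 + w))" for w
    by (rule integral_dominated_convergence[where w="\<lambda>_. B"]) (auto simp: bound lim)
  have intS: "\<bar>LINT e|S. H n (e *\<^sub>R 1 + w)\<bar> \<le> B" for n w
  proof -
    have i: "integrable S (\<lambda>e. H n (e *\<^sub>R 1 + w))"
      by (rule S.integrable_const_bound[where B=B]) (auto simp: bound)
    have "H n x \<le> B" "- B \<le> H n x" for x using bound(1)[of n x] by linarith+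
    then show ?thesis
      using S.integral_le_const[OF i, of B] S.integral_ge_const[OF i, of "- B"]
      by (intro abs_leI) (auto simp: minus_le_iff)
  qed
  have "(\<lambda>n. LINT w|L. LINT e|S. H n (e *\<^sub>R 1 + w)) \<longlonglongrightarrow> (LINT w|L. LINT e|S. h (e *\<^sub>R 1 + w))"
    by (rule integral_dominated_convergence[where w="\<lambda>_. B"]) (auto simp: inner intS)
  then show ?thesis by (simp add: iterated bound)
qed

text \<open>Conditionally on \<open>e\<close>, the covariance is nonnegative by hypothesis; the conditional means are increasing
  in \<open>e\<close>, so their covariance is nonnegative by Chebyshev's inequality.\<close>

lemma covariance_nonneg_smooth_mixture:
  fixes L :: "(real ^ 'd) measure" and f g :: "real ^ 'd \<Rightarrow> real"
  assumes S: "prob_space S" "sets S = sets borel" and L: "prob_space L" "sets L = sets borel"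
    and cov: "\<And>a f g. smoothly_increasing f \<Longrightarrow> smoothly_increasing g \<Longrightarrow>
      (LINT w|L. f (a + w)) * (LINT w|L. g (a + w)) \<le> (LINT w|L. f (a + w) * g (a + w))"
    and f: "smoothly_increasing f" "mono f" and g: "smoothly_increasing g" "mono g"
  defines "\<nu> \<equiv> distr (S \<Otimes>\<^sub>M L) borel (\<lambda>(e, w). e *\<^sub>R 1 + w)"
  shows "(LINT x|\<nu>. f x) * (LINT x|\<nu>. g x) \<le> (LINT x|\<nu>. f x * g x)"
proof -
  interpret S: prob_space S by fact
  interpret L: prob_space L by fact
  interpret P: pair_prob_space S L ..
  note [measurable_cong] = S(2) L(2)
  note [measurable] = smoothly_increasing_borel[OF f(1)] smoothly_increasing_borel[OF g(1)]
  obtain C where C: "\<And>x. \<bar>f x\<bar> \<le> C" "\<And>x. \<bar>g x\<bar> \<le> C"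
  proof -
    obtain Cf Cg where "\<And>x. \<bar>f x\<bar> \<le> Cf" "\<And>x. \<bar>g x\<bar> \<le> Cg"
      using f g unfolding smoothly_increasing_def by metis
    then show ?thesis using that[of "max Cf Cg"] by (meson max.coboundedI1 max.coboundedI2)
  qed
  have C0: "C \<ge> 0" using C(1)[of 0] by linarith
  have fg: "\<bar>f x * g y\<bar> \<le> C * C" for x y
    using C C0 by (auto simp: abs_mult intro!: mult_mono)
  have iterated: "(LINT x|\<nu>. q x) = (LINT e|S. LINT w|L. q (e *\<^sub>R 1 + w))"
    if [measurable]: "q \<in> borel_measurable borel" and q: "\<And>x. \<bar>q x\<bar> \<le> B" for q :: "real ^ 'd \<Rightarrow> real" and B
  proof -
    have "(LINT x|\<nu>. q x) = (LINT z|(S \<Otimes>\<^sub>M L). (case z of (e, w) \<Rightarrow> q (e *\<^sub>R 1 + w)))"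
      unfolding \<nu>_def by (subst integral_distr) (auto intro!: Bochner_Integration.integral_cong)
    also have "\<dots> = (LINT e|S. LINT w|L. q (e *\<^sub>R 1 + w))"
      using q by (intro P.integral_fst[symmetric] P.integrable_const_bound[where B=B]) auto
    finally show ?thesis .
  qed
  define A where "A q e = (LINT w|L. q (e *\<^sub>R 1 + w))" for q :: "real ^ 'd \<Rightarrow> real" and e
  have intL: "integrable L (\<lambda>w. q (e *\<^sub>R 1 + w))"
    if [measurable]: "q \<in> borel_measurable borel" and q: "\<And>x. \<bar>q x\<bar> \<le> B" for q :: "real ^ 'd \<Rightarrow> real" and B e
    by (rule L.integrable_const_bound[where B=B]) (auto simp: q)
  have A_bound: "\<bar>A q e\<bar> \<le> B"
    if m: "q \<in> borel_measurable borel" and q: "\<And>x. \<bar>q x\<bar> \<le> B" for q :: "real ^ 'd \<Rightarrow> real" and B e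
  proof -
    have "q x \<le> B" "- B \<le> q x" for x using q[of x] by linarith+
    then show ?thesis
      using L.integral_le_const[OF intL[OF that, of e], of B] L.integral_ge_const[OF intL[OF that, of e], of "- B"]
      unfolding A_def by (intro abs_leI) (auto simp: minus_le_iff)
  qed
  have A_mono: "mono (A q)" if m: "q \<in> borel_measurable borel" and q: "\<And>x. \<bar>q x\<bar> \<le> C" "mono q" for q
  proof (rule monoI)
    fix e e' :: real assume "e \<le> e'"
    then have "q (e *\<^sub>R 1 + w) \<le> q (e' *\<^sub>R 1 + w)" for w
      by (intro monoD[OF q(2)]) (simp add: less_eq_vec_def)
    then show "A q e \<le> A q e'"
      unfolding A_def by (intro integral_mono intL[OF m q(1)]) auto
  qed
  have [measurable]: "A q \<in> borel_measurable borel" if [measurable]: "q \<in> borel_measurable borel" for q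
    unfolding A_def by measurable
  have "(LINT x|\<nu>. f x) * (LINT x|\<nu>. g x) = (LINT e|S. A f e) * (LINT e|S. A g e)"
    using iterated[OF _ C(1)] iterated[OF _ C(2)] by (simp add: A_def)
  also have "\<dots> \<le> (LINT e|S. A f e * A g e)"
    by (rule chebyshev_covariance[OF S]) (auto intro!: A_mono A_bound C f g)
  also have "\<dots> \<le> (LINT e|S. A (\<lambda>x. f x * g x) e)"
  proof (intro integral_mono)
    have "\<bar>A f e * A g e\<bar> \<le> C * C" for e
      using A_bound[of f C e] A_bound[of g C e] C C0 by (auto simp: abs_mult intro!: mult_mono)
    then show "integrable S (\<lambda>e. A f e * A g e)"
      by (intro S.integrable_const_bound[where B="C * C"]) auto
    have "\<bar>A (\<lambda>x. f x * g x) e\<bar> \<le> C * C" for e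
      by (rule A_bound) (auto simp: fg)
    then show "integrable S (A (\<lambda>x. f x * g x))"
      by (intro S.integrable_const_bound[where B="C * C"]) auto
    show "A f e * A g e \<le> A (\<lambda>x. f x * g x) e" for e
      unfolding A_def by (rule cov[OF f(1) g(1)])
  qed
  also have "\<dots> = (LINT x|\<nu>. f x * g x)"
    using iterated[of "\<lambda>x. f x * g x", OF _ fg] by (simp add: A_def)
  finally show ?thesis .
qed

text \<open>A bounded increasing function need not be continuous almost everywhere for \<open>L\<close>, which may be
  supported on a hyperplane; it is the continuous variable \<open>e\<close> that makes the smooth approximations
  converge almost surely.\<close>

lemma covariance_nonneg_bounded_mixture:
  fixes L :: "(real ^ 'd) measure" and f g :: "real ^ 'd \<Rightarrow> real"
  assumes S: "prob_space S" "sets S = sets borel" "absolutely_continuous lborel S"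
    and L: "prob_space L" "sets L = sets borel"
    and cov: "\<And>a f g. smoothly_increasing f \<Longrightarrow> smoothly_increasing g \<Longrightarrow>
      (LINT w|L. f (a + w)) * (LINT w|L. g (a + w)) \<le> (LINT w|L. f (a + w) * g (a + w))"
    and f: "mono f" "f \<in> borel_measurable borel" "\<And>x. \<bar>f x\<bar> \<le> B"
    and g: "mono g" "g \<in> borel_measurable borel" "\<And>x. \<bar>g x\<bar> \<le> B"
  defines "\<nu> \<equiv> distr (S \<Otimes>\<^sub>M L) borel (\<lambda>(e, w). e *\<^sub>R 1 + w)"
  shows "(LINT x|\<nu>. f x) * (LINT x|\<nu>. g x) \<le> (LINT x|\<nu>. f x * g x)"
proof -
  define \<epsilon> where "\<epsilon> n = 1 / real (Suc n)" for n
  have \<epsilon>: "\<epsilon> n > 0" for n by (simp add: \<epsilon>_def)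
  have \<epsilon>0: "\<epsilon> \<longlonglongrightarrow> 0" unfolding \<epsilon>_def by (rule LIMSEQ_Suc[OF lim_1_over_n])
  obtain F where F: "\<And>n. smoothly_increasing (F n)" "\<And>n. mono (F n)"
    "\<And>n x. f (x - \<epsilon> n *\<^sub>R 1) \<le> F n x" "\<And>n x. F n x \<le> f (x + \<epsilon> n *\<^sub>R 1)"
    using smoothly_increasing_approximation[OF f \<epsilon>] by metis
  obtain G where G: "\<And>n. smoothly_increasing (G n)" "\<And>n. mono (G n)"
    "\<And>n x. g (x - \<epsilon> n *\<^sub>R 1) \<le> G n x" "\<And>n x. G n x \<le> g (x + \<epsilon> n *\<^sub>R 1)"
    using smoothly_increasing_approximation[OF g \<epsilon>] by metis
  note [measurable] = f(2) g(2) smoothly_increasing_borel[OF F(1)] smoothly_increasing_borel[OF G(1)]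
  have B0: "0 \<le> B" using f(3)[of 0] by linarith
  have FB: "\<bar>F n x\<bar> \<le> B" for n x
    using F(3)[where n=n and x=x] F(4)[where n=n and x=x] f(3)[of "x - \<epsilon> n *\<^sub>R 1"] f(3)[of "x + \<epsilon> n *\<^sub>R 1"]
    by linarith
  have GB: "\<bar>G n x\<bar> \<le> B" for n x
    using G(3)[where n=n and x=x] G(4)[where n=n and x=x] g(3)[of "x - \<epsilon> n *\<^sub>R 1"] g(3)[of "x + \<epsilon> n *\<^sub>R 1"]
    by linarith
  have prodB: "\<bar>p * q\<bar> \<le> B * B" if "\<bar>p\<bar> \<le> B" "\<bar>q\<bar> \<le> B" for p q :: real
    using that B0 by (auto simp: abs_mult intro!: mult_mono)
  have transfer: "AE e in S. Q e" if "AE e in lborel. Q e" for Q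
    using absolutely_continuous_AE[OF _ S(3)] that S(2) by simp
  have limF: "AE e in S. (\<lambda>n. F n (e *\<^sub>R 1 + w)) \<longlonglongrightarrow> f (e *\<^sub>R 1 + w)" for w
    by (rule transfer[OF AE_tendsto_along_diagonal[OF f(1) \<epsilon>0 F(3,4)]])
  have limG: "AE e in S. (\<lambda>n. G n (e *\<^sub>R 1 + w)) \<longlonglongrightarrow> g (e *\<^sub>R 1 + w)" for w
    by (rule transfer[OF AE_tendsto_along_diagonal[OF g(1) \<epsilon>0 G(3,4)]])
  have limFG: "AE e in S. (\<lambda>n. F n (e *\<^sub>R 1 + w) * G n (e *\<^sub>R 1 + w)) \<longlonglongrightarrow> f (e *\<^sub>R 1 + w) * g (e *\<^sub>R 1 + w)" for w
    using limF[of w] limG[of w] by eventually_elim (rule tendsto_mult)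
  note mixture = tendsto_integral_diagonal_mixture[OF S(1,2) L, folded \<nu>_def]
  have "(\<lambda>n. LINT x|\<nu>. F n x) \<longlonglongrightarrow> (LINT x|\<nu>. f x)"
    by (rule mixture[where B=B]) (auto simp: FB f limF)
  moreover have "(\<lambda>n. LINT x|\<nu>. G n x) \<longlonglongrightarrow> (LINT x|\<nu>. g x)"
    by (rule mixture[where B=B]) (auto simp: GB g limG)
  moreover have "(\<lambda>n. LINT x|\<nu>. F n x * G n x) \<longlonglongrightarrow> (LINT x|\<nu>. f x * g x)"
  proof (rule mixture[where B="B * B"])
    show "\<bar>F n x * G n x\<bar> \<le> B * B" "\<bar>f x * g x\<bar> \<le> B * B" for n x
      by (rule prodB FB GB f(3) g(3))+
  qed (measurable, rule limFG)
  moreover have "(LINT x|\<nu>. F n x) * (LINT x|\<nu>. G n x) \<le> (LINT x|\<nu>. F n x * G n x)" for n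
    unfolding \<nu>_def by (rule covariance_nonneg_smooth_mixture[OF S(1,2) L cov F(1,2) G(1,2)])
  ultimately show ?thesis
    by (intro LIMSEQ_le[OF tendsto_mult]) auto
qed

text \<open>Truncation at \<open>n\<close> keeps monotonicity and is dominated by \<open>\<bar>f\<bar>\<close>, \<open>\<bar>g\<bar>\<close> and \<open>\<bar>f * g\<bar>\<close>.\<close>

lemma associated_if_bounded_covariance_nonneg:
  fixes \<nu> :: "(real ^ 'd) measure"
  assumes \<nu>: "prob_space \<nu>" "sets \<nu> = sets borel"
    and cov: "\<And>(f :: real ^ 'd \<Rightarrow> real) (g :: real ^ 'd \<Rightarrow> real) B. mono f \<Longrightarrow> f \<in> borel_measurable borel \<Longrightarrow> (\<And>x. \<bar>f x\<bar> \<le> B) \<Longrightarrow>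
      mono g \<Longrightarrow> g \<in> borel_measurable borel \<Longrightarrow> (\<And>x. \<bar>g x\<bar> \<le> B) \<Longrightarrow>
      (LINT x|\<nu>. f x) * (LINT x|\<nu>. g x) \<le> (LINT x|\<nu>. f x * g x)"
  shows "associated \<nu> (\<lambda>x. x)"
  unfolding associated_def
proof (intro allI impI)
  fix f g :: "real ^ 'd \<Rightarrow> real"
  assume mono: "mono f" "mono g" and int: "integrable \<nu> f" "integrable \<nu> g" "integrable \<nu> (\<lambda>x. f x * g x)"
  interpret prob_space \<nu> by fact
  note [measurable_cong] = \<nu>(2)
  have meas[measurable]: "f \<in> borel_measurable borel" "g \<in> borel_measurable borel"
    using int(1,2)[THEN borel_measurable_integrable] by (simp_all add: measurable_cong_sets[OF \<nu>(2) refl])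
  define cut where "cut n y = max (- real n) (min (real n) y)" for n and y :: real
  have cut: "\<bar>cut n y\<bar> \<le> real n" "\<bar>cut n y\<bar> \<le> \<bar>y\<bar>" for n y
    unfolding cut_def by auto
  have cut_mono: "cut n y \<le> cut n z" if "y \<le> z" for n y z
    using that by (auto simp: cut_def)
  have cut_lim: "(\<lambda>n. cut n y) \<longlonglongrightarrow> y" for y
  proof (rule tendsto_eventually)
    obtain N where "\<bar>y\<bar> \<le> real N" using real_arch_simple by blast
    then show "\<forall>\<^sub>F n in sequentially. cut n y = y"
      unfolding eventually_sequentially by (intro exI[of _ N]) (auto simp: cut_def)
  qed
  have [measurable]: "cut n \<in> borel_measurable borel" for n unfolding cut_def by measurable
  have ineq: "(LINT x|\<nu>. cut n (f x)) * (LINT x|\<nu>. cut n (g x)) \<le> (LINT x|\<nu>. cut n (f x) * cut n (g x))" for n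
    using mono by (intro cov[where B="real n"]) (auto simp: mono_def cut cut_mono)
  have limf: "(\<lambda>n. LINT x|\<nu>. cut n (f x)) \<longlonglongrightarrow> (LINT x|\<nu>. f x)"
    by (rule integral_dominated_convergence[where w="\<lambda>x. \<bar>f x\<bar>"]) (use int in \<open>auto simp: cut cut_lim\<close>)
  have limg: "(\<lambda>n. LINT x|\<nu>. cut n (g x)) \<longlonglongrightarrow> (LINT x|\<nu>. g x)"
    by (rule integral_dominated_convergence[where w="\<lambda>x. \<bar>g x\<bar>"]) (use int in \<open>auto simp: cut cut_lim\<close>)
  have limfg: "(\<lambda>n. LINT x|\<nu>. cut n (f x) * cut n (g x)) \<longlonglongrightarrow> (LINT x|\<nu>. f x * g x)"
  proof (rule integral_dominated_convergence[where w="\<lambda>x. \<bar>f x * g x\<bar>"])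
    show "integrable \<nu> (\<lambda>x. \<bar>f x * g x\<bar>)" using int by auto
    show "AE x in \<nu>. (\<lambda>n. cut n (f x) * cut n (g x)) \<longlonglongrightarrow> f x * g x"
      by (intro AE_I2 tendsto_mult cut_lim)
    show "AE x in \<nu>. norm (cut n (f x) * cut n (g x)) \<le> \<bar>f x * g x\<bar>" for n
      by (intro AE_I2) (auto simp: abs_mult cut intro!: mult_mono)
  qed measurable
  have "(LINT x|\<nu>. f x) * (LINT x|\<nu>. g x) \<le> (LINT x|\<nu>. f x * g x)"
    by (rule LIMSEQ_le[OF tendsto_mult[OF limf limg] limfg]) (use ineq in auto)
  moreover have "covariance \<nu> f g = (LINT x|\<nu>. f x * g x) - (LINT x|\<nu>. f x) * (LINT x|\<nu>. g x)"
  proof -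
    have "covariance \<nu> f g = (LINT x|\<nu>. f x * g x - (LINT x|\<nu>. g x) * f x - (LINT x|\<nu>. f x) * g x
        + (LINT x|\<nu>. f x) * (LINT x|\<nu>. g x))"
      unfolding covariance_def by (intro Bochner_Integration.integral_cong refl) (simp add: algebra_simps)
    also have "\<dots> = (LINT x|\<nu>. f x * g x) - (LINT x|\<nu>. f x) * (LINT x|\<nu>. g x)"
      using int by (simp add: prob_space)
    finally show ?thesis .
  qed
  ultimately show "0 \<le> covariance \<nu> f g" by simp
qed

theorem mainTheorem4:
  fixes M :: "'a measure" and Y :: "'a \<Rightarrow> real ^ 'd" and \<Gamma> :: "real ^ 'd ^ 'd"
  assumes "prob_space M"
    and "Y \<in> borel_measurable M"
    and "husler_reiss M Y \<Gamma>"
    and "\<forall>i j k. \<Gamma> $ i $ j \<le> \<Gamma> $ i $ k + \<Gamma> $ j $ k"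
  shows "extremal_associated M Y"
  unfolding extremal_associated_def
proof
  fix k
  obtain L where "extremal_function_law M Y k L"
    and G: "gaussian_vector L (- {k}) (\<lambda>i w. w $ i) (\<lambda>i. - Sigma_k \<Gamma> k i i / 2) (Sigma_k \<Gamma> k)"
    using assms(3) unfolding husler_reiss_def by blast
  then have L: "prob_space L" "sets L = sets borel" "AE w in L. w $ k = 0"
    and law: "exceedance_law M Y k =
       distr (standard_exponential \<Otimes>\<^sub>M L) borel (\<lambda>(e, w). e *\<^sub>R 1 + w)"
    by (auto simp: extremal_function_law_def)
  note [measurable_cong] = L(2)
  \<comment> \<open>The metric property says exactly that these covariances are nonnegative.\<close>
  have nonneg: "Sigma_k \<Gamma> k i j \<ge> 0" for i j
    using assms(4) by (simp add: Sigma_k_def)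
  define m :: "real ^ 'd" where "m = (\<chi> i. if i = k then 0 else - Sigma_k \<Gamma> k i i / 2)"
  define C where "C = distr L borel (\<lambda>w. w - m)"
  have C: "centred_gaussian C" "\<And>i j. (LINT x|C. x $ i * x $ j) \<ge> 0"
    using gaussian_vector_centre[OF L G nonneg] by (simp_all add: C_def m_def)
  have cov: "(LINT w|L. f (a + w)) * (LINT w|L. g (a + w)) \<le> (LINT w|L. f (a + w) * g (a + w))"
    if f: "smoothly_increasing f" and g: "smoothly_increasing g" for a f g
  proof -
    note [measurable] = smoothly_increasing_borel[OF f] smoothly_increasing_borel[OF g]
    have shift: "(LINT x|C. q ((a + m) + x)) = (LINT w|L. q (a + w))"
      if [measurable]: "q \<in> borel_measurable borel" for q :: "real ^ 'd \<Rightarrow> real"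
      unfolding C_def by (subst integral_distr) auto
    show ?thesis
      using gaussian_covariance_nonneg_smooth[OF C f g, of "a + m"]
        shift[of f] shift[of g] shift[of "\<lambda>x. f x * g x"] by simp
  qed
  have S: "prob_space standard_exponential" "sets standard_exponential = sets borel"
    "absolutely_continuous lborel standard_exponential"
    unfolding standard_exponential_def
    by (auto intro: prob_space_exponential_density absolutely_continuousI_density)
  interpret S: prob_space standard_exponential by (rule S)
  interpret L: prob_space L by (rule L)
  interpret P: pair_prob_space standard_exponential L ..
  note [measurable_cong] = S(2)
  show "associated (exceedance_law M Y k) (\<lambda>y. y)"
  proof (rule associated_if_bounded_covariance_nonneg)
    show "prob_space (exceedance_law M Y k)"
      unfolding law by (rule P.prob_space_distr) measurable
    show "sets (exceedance_law M Y k) = sets borel" by (simp add: law)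
  qed (unfold law, rule covariance_nonneg_bounded_mixture[OF S L(1,2) cov])
qed

end
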